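(* Let $\alpha\in(0,1)$, let $r_0=\dfrac{-1+\sqrt{1+4\alpha h_1^2}}{2\alpha h_1}$, and let $\alpha_0\in(0,1)$ be the smallest solution $\alpha$ of $$1-\frac{r_0^2\cos^2\theta\,(1-\alpha r_0^2)^2}{(1+\alpha^2r_0^4-2\alpha r_0^2\cos2\theta)^2h_1^2}-\frac{r_0^2\sin^2\theta\,(1+\alpha r_0^2)^2}{(1+\alpha^2r_0^4-2\alpha r_0^2\cos2\theta)^2h_2^2}=0,$$ where $\theta\in(0,\pi/2)$ (that is, the smallest $\alpha\in(0,1)$ for which the equation holds for some $\theta\in(0,\pi/2)$; here $r_0,h_1,h_2$ depend on $\alpha$). If $f\in\mathcal{BS}^*(\alpha)$, then for the disc $|z|\le r_b<1$, $f\in\mathcal{F}[A,B]$, where $$r_b=\begin{cases}r_0,&\text{for } A=-B=\alpha\le\alpha_0,\\[4pt] r_1:=\dfrac{-1+\sqrt{1+4\alpha h_2^2}}{2\alpha h_2},&\text{for } A=-B=\alpha>\alpha_0,\\[8pt] r_2:=\dfrac{-1+\sqrt{1+4\alpha(k_1+k)^2}}{2\alpha(k_1+k)},&\text{for } A=\alpha e^{i\gamma}\text{ and }B=\alpha e^{-i\gamma}.\end{cases}$$ Moreover the radii $r_0$ and $r_2$ are sharp (in the respective cases they cannot be replaced by larger numbers valid for all $f\in\mathcal{BS}^*(\alpha)$).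
   Context: $\mathbb{D}=\{z\in\mathbb{C}:|z|<1\}$; $\mathcal{A}$ is the class of analytic functions $f$ on $\mathbb{D}$ with $f(z)=z+a_2z^2+a_3z^3+\cdots$. For analytic $f,g$ on $\mathbb{D}$, $f\prec g$ means $f=g\circ\omega$ for some Schwarz function $\omega$ (analytic on $\mathbb{D}$, $\omega(0)=0$, $|\omega|<1$). For $0<\alpha\le1$, and either $A=-B=\alpha$, or $A=\alpha e^{i\gamma}$, $B=\alpha e^{-i\gamma}$ with $0<\gamma\le\pi/2$, define $$\psi_{A,B}(z)=\frac{1}{A-B}\log\left(\frac{1+Az}{1+Bz}\right),\quad z\in\mathbb{D},$$ with the branch of the logarithm vanishing at $z=0$, and $$\mathcal{F}[A,B]=\left\{f\in\mathcal{A}:\ \frac{zf'(z)}{f(z)}-1\prec\psi_{A,B}(z)\right\}.$$ Also $$\mathcal{BS}^*(\alpha)=\left\{f\in\mathcal{A}:\ \frac{zf'(z)}{f(z)}-1\prec\frac{z}{1-\alpha z^2}\right\}.$$ Saying that $f\in\mathcal{F}[A,B]$ for the disc of radius $\rho$ means that the rescaled function $z\mapsto f(\rho z)/\rho$ belongs to $\mathcal{F}[A,B]$; equivalently (as $\psi_{A,B}$ is univalent), $zf'(z)/f(z)-1\in\psi_{A,B}(\mathbb{D})$ for all $|z|<\rho$. Notation: $$h_1=\frac{1}{2\alpha}\log\left(\frac{1+\alpha}{1-\alpha}\right),\quad h_2=\frac{1}{2\alpha}\sin^{-1}\left(\frac{2\alpha}{1+\alpha^2}\right),$$ $$k_1=\frac{1}{2\alpha\sin\gamma}\sin^{-1}\left(\frac{2\alpha\sin\gamma}{\sqrt{1+\alpha^4-2\alpha^2\cos2\gamma}}\right),\quad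 k=\frac{1}{2\alpha\sin\gamma}\tan^{-1}\left(\frac{\alpha^2\sin2\gamma}{\alpha^2\cos2\gamma-1}\right).$$
   Formalization: α₀ is taken as the infimum, not the smallest element, of the set of α in (0,1) for which the equation holds for some θ in (0,π/2): this set is open and non-empty, so a smallest solution does not exist (at the infimum θ tends to the excluded value 0). *)

theory Defs
  imports "HOL-Complex_Analysis.Complex_Analysis"
begin

definition class_A :: "(complex \<Rightarrow> complex) set" where
  "class_A = {f. f holomorphic_on ball 0 1 \<and> f 0 = 0 \<and> deriv f 0 = 1}"

definition schwarz_function :: "(complex \<Rightarrow> complex) \<Rightarrow> bool" where
  "schwarz_function \<omega> \<longleftrightarrow>
     \<omega> holomorphic_on ball 0 1 \<and> \<omega> 0 = 0 \<and> (\<forall>z\<in>ball 0 1. norm (\<omega> z) < 1)"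

definition subordinate :: "(complex \<Rightarrow> complex) \<Rightarrow> (complex \<Rightarrow> complex) \<Rightarrow> bool" where
  "subordinate f g \<longleftrightarrow>
     f holomorphic_on ball 0 1 \<and> g holomorphic_on ball 0 1 \<and>
     (\<exists>\<omega>. schwarz_function \<omega> \<and> (\<forall>z\<in>ball 0 1. f z = g (\<omega> z)))"

text \<open>
  The analytic function \<open>z f'(z) / f(z) - 1\<close> for \<open>f\<close> in class \<open>A\<close>, whose removable singularity
  at the origin is filled in with its limit \<open>0\<close>.  No condition \<open>f z \<noteq> 0\<close> is needed for \<open>z \<noteq> 0\<close>:
  at a further zero of \<open>f\<close> the quotient has a pole, so this function is not holomorphic on the
  unit disc (whatever value division by zero yields there) and is subordinate to nothing.
\<close>
definition starlike_expr :: "(complex \<Rightarrow> complex) \<Rightarrow> complex \<Rightarrow> complex" where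
  "starlike_expr f z = (if z = 0 then 0 else z * deriv f z / f z - 1)"

text \<open>
  For \<open>norm A < 1\<close> and \<open>norm B < 1\<close> both \<open>1 + A * z\<close> and \<open>1 + B * z\<close> have positive real part on
  the unit disc, so their quotient avoids the cut of the principal logarithm; \<open>Ln\<close> is therefore
  the analytic branch vanishing at \<open>z = 0\<close>.
\<close>
definition psi :: "complex \<Rightarrow> complex \<Rightarrow> complex \<Rightarrow> complex" where
  "psi A B z = 1 / (A - B) * Ln ((1 + A * z) / (1 + B * z))"

definition class_F :: "complex \<Rightarrow> complex \<Rightarrow> (complex \<Rightarrow> complex) set" where
  "class_F A B = {f \<in> class_A. subordinate (starlike_expr f) (psi A B)}"

definition class_BS :: "real \<Rightarrow> (complex \<Rightarrow> complex) set" where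
  "class_BS \<alpha> =
     {f \<in> class_A. subordinate (starlike_expr f) (\<lambda>z. z / (1 - of_real \<alpha> * z\<^sup>2))}"

text \<open>
  \<open>f\<close> belongs to \<open>class_F A B\<close> for the disc of radius \<open>\<rho>\<close>.  Only \<open>0 < \<rho> \<le> 1\<close> is meaningful.
\<close>
definition in_F_on_disc :: "complex \<Rightarrow> complex \<Rightarrow> real \<Rightarrow> (complex \<Rightarrow> complex) \<Rightarrow> bool" where
  "in_F_on_disc A B \<rho> f \<longleftrightarrow> (\<lambda>z. f (of_real \<rho> * z) / of_real \<rho>) \<in> class_F A B"

definition BS_in_F_radius :: "real \<Rightarrow> complex \<Rightarrow> complex \<Rightarrow> real \<Rightarrow> bool" where
  "BS_in_F_radius \<alpha> A B \<rho> \<longleftrightarrow> (\<forall>f\<in>class_BS \<alpha>. in_F_on_disc A B \<rho> f)"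

text \<open>
  Members of \<open>class_BS \<alpha>\<close> are only defined on the unit disc, so the larger radii to be excluded
  are those up to \<open>1\<close>.
\<close>
definition sharp_BS_in_F_radius :: "real \<Rightarrow> complex \<Rightarrow> complex \<Rightarrow> real \<Rightarrow> bool" where
  "sharp_BS_in_F_radius \<alpha> A B \<rho> \<longleftrightarrow> (\<forall>\<rho>'. \<rho> < \<rho>' \<and> \<rho>' \<le> 1 \<longrightarrow> \<not> BS_in_F_radius \<alpha> A B \<rho>')"

definition h1 :: "real \<Rightarrow> real" where
  "h1 \<alpha> = 1 / (2 * \<alpha>) * ln ((1 + \<alpha>) / (1 - \<alpha>))"

definition h2 :: "real \<Rightarrow> real" where
  "h2 \<alpha> = 1 / (2 * \<alpha>) * arcsin (2 * \<alpha> / (1 + \<alpha>\<^sup>2))"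

definition k1 :: "real \<Rightarrow> real \<Rightarrow> real" where
  "k1 \<alpha> \<gamma> = 1 / (2 * \<alpha> * sin \<gamma>) *
     arcsin (2 * \<alpha> * sin \<gamma> / sqrt (1 + \<alpha>^4 - 2 * \<alpha>\<^sup>2 * cos (2 * \<gamma>)))"

definition k0 :: "real \<Rightarrow> real \<Rightarrow> real" where
  "k0 \<alpha> \<gamma> = 1 / (2 * \<alpha> * sin \<gamma>) *
     arctan (\<alpha>\<^sup>2 * sin (2 * \<gamma>) / (\<alpha>\<^sup>2 * cos (2 * \<gamma>) - 1))"

definition r0 :: "real \<Rightarrow> real" where
  "r0 \<alpha> = (- 1 + sqrt (1 + 4 * \<alpha> * (h1 \<alpha>)\<^sup>2)) / (2 * \<alpha> * h1 \<alpha>)"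

definition r1 :: "real \<Rightarrow> real" where
  "r1 \<alpha> = (- 1 + sqrt (1 + 4 * \<alpha> * (h2 \<alpha>)\<^sup>2)) / (2 * \<alpha> * h2 \<alpha>)"

definition r2 :: "real \<Rightarrow> real \<Rightarrow> real" where
  "r2 \<alpha> \<gamma> = (- 1 + sqrt (1 + 4 * \<alpha> * (k1 \<alpha> \<gamma> + k0 \<alpha> \<gamma>)\<^sup>2)) / (2 * \<alpha> * (k1 \<alpha> \<gamma> + k0 \<alpha> \<gamma>))"

definition alpha0_equation :: "real \<Rightarrow> real \<Rightarrow> bool" where
  "alpha0_equation \<alpha> \<theta> \<longleftrightarrow>
     1 - (r0 \<alpha>)\<^sup>2 * (cos \<theta>)\<^sup>2 * (1 - \<alpha> * (r0 \<alpha>)\<^sup>2)\<^sup>2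
           / ((1 + \<alpha>\<^sup>2 * (r0 \<alpha>)^4 - 2 * \<alpha> * (r0 \<alpha>)\<^sup>2 * cos (2 * \<theta>))\<^sup>2 * (h1 \<alpha>)\<^sup>2)
       - (r0 \<alpha>)\<^sup>2 * (sin \<theta>)\<^sup>2 * (1 + \<alpha> * (r0 \<alpha>)\<^sup>2)\<^sup>2
           / ((1 + \<alpha>\<^sup>2 * (r0 \<alpha>)^4 - 2 * \<alpha> * (r0 \<alpha>)\<^sup>2 * cos (2 * \<theta>))\<^sup>2 * (h2 \<alpha>)\<^sup>2) = 0"

definition alpha0_solutions :: "real set" where
  "alpha0_solutions = {\<alpha>. 0 < \<alpha> \<and> \<alpha> < 1 \<and> (\<exists>\<theta>. 0 < \<theta> \<and> \<theta> < pi / 2 \<and> alpha0_equation \<alpha> \<theta>)}"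

text \<open>
  The threshold is the infimum of the solutions and not a least element, because there is none.
  Put \<open>q = \<alpha> (r0 \<alpha>)\<^sup>2\<close> and \<open>u = (sin \<theta>)\<^sup>2\<close>.  As \<open>r0 \<alpha> = (1 - q) h1 \<alpha>\<close>, clearing the denominator
  turns the equation into \<open>u ((1 - q)\<^sup>2 E + 16 q\<^sup>2 u) = 0\<close>, where
  \<open>E = 8 q + (1 - q)\<^sup>2 - (1 + q)\<^sup>2 (h1 \<alpha> / h2 \<alpha>)\<^sup>2\<close>.  The second factor is positive at \<open>u = 1\<close>,
  so a root with \<open>0 < u < 1\<close> exists iff \<open>E < 0\<close>.  The solutions thus form an open
  set; as \<open>\<alpha>\<close> decreases to the infimum, the angle \<open>\<theta>\<close> tends to the excluded value \<open>0\<close>.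
\<close>
definition alpha0 :: real where
  "alpha0 = Inf alpha0_solutions"

end

(*
  The function psi maps the unit disc conformally onto the set of all w with
  |E - 1| < |A - B E|, where E = exp ((A - B) w); its inverse is w |-> (E - 1) / (A - B E).
  By the Schwarz lemma, membership in F[A,B] on the disc of radius rho amounts to
  F(z) = z / (1 - alpha z^2) mapping that disc into this region, and the function f with
  z f'(z) / f(z) - 1 = F(z) gives sharpness as soon as F(rho) lies on the boundary.

  With (A - B) w = p + i q and |A| = |B| = alpha, the region is
  (1 - alpha^2) cosh p < Re ((1 - conj(A) B) exp(i q)).  For the radii r1 and r2, F maps the disc
  into a round disc about 0, which lies in the region since cosh p <= exp (p^2 / 2) while
  cos (t + delta) exp (t^2 / 2) decreases in t.

  For r0 the image of the circle |z| = r0 has to be compared with the region itself.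
  Concavity of ln (cosh (sqrt s)) bounds cosh p, a Taylor estimate bounds cos q from below, and
  the remaining algebraic inequality follows from the two facts that the threshold equation
  encodes: alpha0_gap <= 0 for alpha <= alpha0, and alpha0 <= 33/50.
*)
theory Submission
  imports Defs
begin

section \<open>Elementary inequalities\<close>

text \<open>Write F for \<open>bs_fun \<alpha>\<close>. Each radius solves F(r) = H for real r,
  where H is the distance from 0 to a boundary point of the range of psi: \<open>h1\<close> = psi(1)
  and \<open>h2\<close> = |psi(i)| for A = -B, and \<open>k1 + k0\<close> = psi(1) in the other
  case. For A = -B the range is longer along the real axis, so a round disc about 0 can only give
  \<open>r1\<close>, and F(r1) = \<open>h2\<close> is then no boundary point. The threshold equation
  says that F(r0 exp(i theta)) lies on the ellipse with semi-axes \<open>h1\<close> and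
  \<open>h2\<close>. The image touches this ellipse at the vertex \<open>h1\<close> for every
  \<alpha>, and \<open>alpha0_gap \<alpha> \<le> 0\<close> keeps the image inside it. The comparison
  with the range of psi is also an equality at that vertex, so every estimate for \<open>r0\<close>
  has to be exact to first order there. To first order the range requires (1 + m) (1 + \<alpha>^2)
  h1 \<le> 1 + 2 m with m = 4 \<alpha> h1^2, and the gap condition yields this because (1 +
  \<alpha>^2) h2^2 \<le> h1. Bounding \<alpha> by 33/50 leaves room for the higher orders.\<close>

lemma sinh_le_mult_cosh:
  fixes x :: real
  assumes "0 \<le> x"
  shows "sinh x \<le> x * cosh x"
proof -
  have "(\<lambda>t. t * cosh t - sinh t) 0 \<le> (\<lambda>t. t * cosh t - sinh t) x"
    by (rule DERIV_nonneg_imp_nondecreasing[OF assms])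
       (auto intro!: derivative_eq_intros exI mult_nonneg_nonneg)
  then show ?thesis by simp
qed

lemma le_sinh:
  fixes x :: real
  assumes "0 \<le> x"
  shows "x \<le> sinh x"
proof -
  have "(\<lambda>t. sinh t - t) 0 \<le> (\<lambda>t. sinh t - t) x"
    by (rule DERIV_nonneg_imp_nondecreasing[OF assms])
       (auto intro!: derivative_eq_intros exI simp: cosh_real_ge_1)
  then show ?thesis by simp
qed

lemma cosh_le_exp_half_square: "cosh x \<le> exp (x\<^sup>2 / 2)" for x :: real
proof -
  have *: "cosh x \<le> exp (x\<^sup>2 / 2)" if "0 \<le> x" for x :: real
  proof -
    have "(\<lambda>t. cosh t * exp (- (t\<^sup>2) / 2)) 0 \<ge> (\<lambda>t. cosh t * exp (- (t\<^sup>2) / 2)) x"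
    proof (rule DERIV_nonpos_imp_nonincreasing[OF that])
      fix t :: real assume t: "0 \<le> t"
      have "((\<lambda>t. cosh t * exp (- (t\<^sup>2) / 2)) has_real_derivative
          (sinh t - t * cosh t) * exp (- (t\<^sup>2) / 2)) (at t)"
        by (auto intro!: derivative_eq_intros simp: algebra_simps)
      moreover have "(sinh t - t * cosh t) * exp (- (t\<^sup>2) / 2) \<le> 0"
        using sinh_le_mult_cosh[OF t] by (simp add: mult_nonpos_nonneg)
      ultimately show "\<exists>y. ((\<lambda>t. cosh t * exp (- (t\<^sup>2) / 2)) has_real_derivative y) (at t) \<and> y \<le> 0"
        by blast
    qed
    then show ?thesis by (simp add: exp_minus field_simps)
  qed
  show ?thesis using *[of "\<bar>x\<bar>"] by simp
qed

text \<open>Concavity of tanh is used as monotonicity of tanh x / x, whose derivative has the sign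
  of x - sinh x cosh x.\<close>

lemma tanh_concave:
  fixes t P :: real
  assumes "0 \<le> t" "t \<le> P"
  shows "t * tanh P \<le> P * tanh t"
proof (cases "t = 0")
  case False
  then have "0 < t" using assms by simp
  have "(\<lambda>x. tanh x / x) t \<ge> (\<lambda>x. tanh x / x) P"
  proof (rule DERIV_nonpos_imp_nonincreasing[OF assms(2)])
    fix x :: real assume "t \<le> x"
    then have x: "0 < x" using \<open>0 < t\<close> by simp
    have d: "((\<lambda>x. tanh x / x) has_real_derivative ((1 - (tanh x)\<^sup>2) * x - tanh x) / x\<^sup>2) (at x)"
      using x by (auto intro!: derivative_eq_intros simp: power2_eq_square)
    have "x \<le> sinh x * cosh x"
      using le_sinh[of x] x mult_mono[of x "sinh x" 1 "cosh x"] cosh_real_ge_1[of x] by simp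
    then have "x / (cosh x)\<^sup>2 \<le> tanh x"
      by (simp add: tanh_def field_simps power2_eq_square)
    moreover have "1 - (tanh x)\<^sup>2 = 1 / (cosh x)\<^sup>2"
      using cosh_square_eq[of x] cosh_real_nonzero[of x]
      by (simp add: tanh_def power_divide diff_divide_eq_iff del: cosh_real_nonzero) (metis add_diff_cancel_left' diff_divide_distrib divide_self_if power_eq_0_iff cosh_real_nonzero add.commute)
    ultimately have "((1 - (tanh x)\<^sup>2) * x - tanh x) / x\<^sup>2 \<le> 0"
      by (simp add: divide_nonpos_nonneg)
    with d show "\<exists>y. ((\<lambda>x. tanh x / x) has_real_derivative y) (at x) \<and> y \<le> 0"
      by blast
  qed
  then show ?thesis using \<open>0 < t\<close> assms by (simp add: field_simps)
qed auto

text \<open>Concavity of \<open>ln (cosh (sqrt s))\<close> as a function of \<open>s\<close>: the graph lies below its tangent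
  at \<open>s = P\<^sup>2\<close>.\<close>
lemma cosh_le_cosh_exp:
  fixes p P :: real
  assumes "0 < P" "\<bar>p\<bar> \<le> P"
  shows "cosh p \<le> cosh P * exp (- (tanh P / (2 * P) * (P\<^sup>2 - p\<^sup>2)))"
proof -
  \<comment> \<open>The derivative of ln (cosh (sqrt s)) at s = P^2.\<close>
  define c where "c = tanh P / (2 * P)"
  have "(\<lambda>t. cosh t * exp (- c * t\<^sup>2)) \<bar>p\<bar> \<le> (\<lambda>t. cosh t * exp (- c * t\<^sup>2)) P"
  proof (rule DERIV_nonneg_imp_nondecreasing[OF assms(2)])
    fix t :: real assume t: "\<bar>p\<bar> \<le> t" "t \<le> P"
    have d: "((\<lambda>t. cosh t * exp (- c * t\<^sup>2)) has_real_derivative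
        (sinh t - 2 * c * t * cosh t) * exp (- c * t\<^sup>2)) (at t)"
      by (auto intro!: derivative_eq_intros simp: algebra_simps)
    have "t * tanh P \<le> P * tanh t" using t by (intro tanh_concave) auto
    then have "2 * c * t \<le> tanh t" using assms by (simp add: c_def field_simps)
    then have "0 \<le> sinh t - 2 * c * t * cosh t" by (simp add: tanh_def field_simps)
    with d show "\<exists>y. ((\<lambda>t. cosh t * exp (- c * t\<^sup>2)) has_real_derivative y) (at t) \<and> 0 \<le> y"
      by (meson exp_ge_zero mult_nonneg_nonneg)
  qed
  then have "cosh p \<le> cosh P * (exp (- c * P\<^sup>2) / exp (- c * p\<^sup>2))"
    by (simp add: field_simps)
  also have "exp (- c * P\<^sup>2) / exp (- c * p\<^sup>2) = exp (- (c * (P\<^sup>2 - p\<^sup>2)))"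
    by (simp flip: exp_diff add: algebra_simps)
  finally show ?thesis by (simp add: c_def)
qed

section \<open>Taylor bounds for exp and cos\<close>

lemma exp_minus_le_poly:
  fixes t :: real
  assumes "0 \<le> t"
  shows "exp (- t) \<le> 1 - t + t^2 / 2 - t^3 / 6 + t^4 / 24"
proof (cases "t = 0")
  case False
  obtain u where "exp (- t) = (\<Sum>m<5. ((- t) ^ m) / fact m) + (exp u / fact 5) * (- t) ^ 5"
    using Maclaurin_exp_lt[of "- t" 5] False by auto
  moreover have "(exp u / fact 5) * (- t) ^ 5 \<le> 0"
    using assms by (simp add: mult_nonneg_nonpos)
  ultimately show ?thesis
    by (simp add: eval_nat_numeral sum.lessThan_Suc algebra_simps)
qed simp

lemma cos_ge_poly: "1 - x^2 / 2 + x^4 / 24 - x^6 / 720 \<le> cos x" for x :: real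
proof -
  obtain t where "cos x = (\<Sum>m<6. cos_coeff m * x ^ m) + (cos (t + 1/2 * real 6 * pi) / fact 6) * x ^ 6"
    using Maclaurin_cos_expansion[of x 6] by blast
  moreover have "{..<6::nat} = {0, 1, 2, 3, 4, 5}" by auto
  then have "(\<Sum>m<6. cos_coeff m * x ^ m) = 1 - x^2 / 2 + x^4 / 24"
    by (simp add: cos_coeff_def fact_numeral)
  moreover have "cos (t + 1/2 * real 6 * pi) / fact 6 * x^6 \<ge> - 1 / 720 * x^6"
    by (intro mult_right_mono) (auto simp: fact_numeral field_simps)
  ultimately show ?thesis by simp
qed

text \<open>The series of - ln (cos x) starts with x^2/2 + x^4/12. Raising 1/12 to 1/9 pays for all
  later terms while x^2 \<le> 4/5, a range that just covers the imaginary parts met on the circle of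
  radius \<open>r0\<close>.\<close>

lemma exp_le_cos:
  fixes x :: real
  assumes "x\<^sup>2 \<le> 4 / 5"
  shows "exp (- (x^2 / 2 + x^4 / 9)) \<le> cos x"
proof -
  define y where "y = x\<^sup>2"
  have y: "0 \<le> y" "y \<le> 4 / 5" using assms by (auto simp: y_def)
  define t where "t = y / 2 + y\<^sup>2 / 9"
  have "exp (- t) \<le> 1 - t + t^2 / 2 - t^3 / 6 + t^4 / 24"
    by (rule exp_minus_le_poly) (use y in \<open>auto simp: t_def\<close>)
  also have "\<dots> \<le> 1 - y / 2 + y^2 / 24 - y^3 / 720"
  proof -
    have sq: "y\<^sup>2 \<le> 16 / 25" using power_mono[OF y(2,1), of 2] by (simp add: power2_eq_square)
    have cu: "y^3 \<le> 64 / 125" using power_mono[OF y(2,1), of 3] by (simp add: eval_nat_numeral)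
    \<comment> \<open>The coefficient of y^2 below is positive, so y^2 may be replaced by its
      tangent at the endpoint 4/5; what remains is linear in y.\<close>
    have "0 \<le> (y - 4 / 5)\<^sup>2" by simp
    then have "0 \<le> 1/36 - 13/360 * y + 53/10368 * y\<^sup>2"
      using y by (simp add: power2_diff power2_eq_square[of "4/5"] power2_eq_square[of "4::real"] power_divide)
    moreover have "0 \<le> y^3 * (1/1296 - 19/34992 * y - 1/8748 * y\<^sup>2 - 1/157464 * y^3)"
      using y sq cu by (intro mult_nonneg_nonneg) auto
    ultimately have "0 \<le> y\<^sup>2 * (1/36 - 13/360 * y + 53/10368 * y\<^sup>2
        + y^3 * (1/1296 - 19/34992 * y - 1/8748 * y\<^sup>2 - 1/157464 * y^3))"
      by (intro mult_nonneg_nonneg) auto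
    also have "\<dots> = (1 - y / 2 + y^2 / 24 - y^3 / 720) - (1 - t + t^2 / 2 - t^3 / 6 + t^4 / 24)"
      unfolding t_def by (simp add: field_simps) algebra
    finally show ?thesis by simp
  qed
  also have "\<dots> \<le> cos x"
    using cos_ge_poly[of x] by (simp add: y_def flip: power_mult)
  finally show ?thesis by (simp add: t_def y_def flip: power_mult)
qed

section \<open>Partial-sum bounds for artanh and arctan\<close>

lemma has_real_derivative_half_ln_diff:
  fixes x :: real
  assumes "\<bar>x\<bar> < 1"
  shows "((\<lambda>x. (ln (1 + x) - ln (1 - x)) / 2) has_real_derivative 1 / (1 - x\<^sup>2)) (at x)"
proof -
  have "1 + x \<noteq> 0" "1 - x \<noteq> 0" using assms by auto
  moreover from this have "(1 + x) * (1 - x) \<noteq> 0" by simp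
  moreover have "1 - x\<^sup>2 = (1 + x) * (1 - x)" by algebra
  ultimately have "(1 / (1 + x) + 1 / (1 - x)) / 2 = 1 / (1 - x\<^sup>2)"
    by (simp add: divide_simps)
  moreover have "((\<lambda>x. (ln (1 + x) - ln (1 - x)) / 2) has_real_derivative
      (1 / (1 + x) + 1 / (1 - x)) / 2) (at x)"
    using assms by (auto intro!: derivative_eq_intros)
  ultimately show ?thesis by (metis (no_types, lifting))
qed

lemma artanh_lower:
  fixes a :: real
  assumes "0 \<le> a" "a < 1"
  shows "a + a^3 / 3 + a^5 / 5 + a^7 / 7 \<le> ln ((1 + a) / (1 - a)) / 2"
proof -
  define f where "f = (\<lambda>x::real. (ln (1 + x) - ln (1 - x)) / 2 - (x + x^3 / 3 + x^5 / 5 + x^7 / 7))"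
  have "f 0 \<le> f a"
  proof (rule DERIV_nonneg_imp_nondecreasing[OF assms(1)])
    fix x assume x: "0 \<le> x" "x \<le> a"
    have x2: "x^2 < 1" using x assms by (simp add: abs_square_less_1)
    have "(f has_real_derivative (1 / (1 - x^2) - (1 + x^2 + x^4 + x^6))) (at x)"
      unfolding f_def using x assms
      by (intro DERIV_diff has_real_derivative_half_ln_diff) (auto intro!: derivative_eq_intros)
    moreover have "1 / (1 - x^2) - (1 + x^2 + x^4 + x^6) = x^8 / (1 - x^2)"
      using x2 by (simp add: field_simps)
    ultimately show "\<exists>y. (f has_real_derivative y) (at x) \<and> 0 \<le> y"
      using x2 by (intro exI[of _ "x^8 / (1 - x^2)"]) simp
  qed
  then show ?thesis using assms by (simp add: f_def ln_div)
qed

text \<open>From a^7/7 on, the series is dominated by the geometric series with first term a^7/7 and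
  ratio a^2.\<close>

lemma artanh_upper:
  fixes a :: real
  assumes "0 \<le> a" "a < 1"
  shows "ln ((1 + a) / (1 - a)) / 2 \<le> a + a^3 / 3 + a^5 / 5 + a^7 / (7 * (1 - a^2))"
proof -
  define f where "f = (\<lambda>x::real. (x + x^3 / 3 + x^5 / 5 + x^7 / (7 * (1 - x^2))) - (ln (1 + x) - ln (1 - x)) / 2)"
  have "f 0 \<le> f a"
  proof (rule DERIV_nonneg_imp_nondecreasing[OF assms(1)])
    fix x assume x: "0 \<le> x" "x \<le> a"
    have x2: "x^2 < 1" using x assms by (simp add: abs_square_less_1)
    have n: "7 * (1 - x^2) \<noteq> 0" using x2 by simp
    have "((\<lambda>x. x^7 / (7 * (1 - x^2))) has_real_derivative
        (7 * x^6 * (7 * (1 - x^2)) - x^7 * (- 14 * x)) / (7 * (1 - x^2) * (7 * (1 - x^2)))) (at x)"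
      using n by (auto intro!: derivative_eq_intros)
    moreover have "(7 * x^6 * (7 * (1 - x^2)) - x^7 * (- 14 * x)) / (7 * (1 - x^2) * (7 * (1 - x^2)))
        = x^6 / (1 - x^2) + 2 * x^8 / (7 * (1 - x^2)^2)"
      using x2 by (simp add: divide_simps) algebra
    ultimately have d: "((\<lambda>x. x^7 / (7 * (1 - x^2))) has_real_derivative
        (x^6 / (1 - x^2) + 2 * x^8 / (7 * (1 - x^2)^2))) (at x)" by simp
    have "(f has_real_derivative (1 + x^2 + x^4 + (x^6 / (1 - x^2) + 2 * x^8 / (7 * (1 - x^2)^2))
        - 1 / (1 - x^2))) (at x)"
      unfolding f_def using x assms
      by (intro DERIV_diff has_real_derivative_half_ln_diff DERIV_add[OF _ d])
         (auto intro!: derivative_eq_intros)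
    moreover have "1 + x^2 + x^4 + (x^6 / (1 - x^2) + 2 * x^8 / (7 * (1 - x^2)^2))
        - 1 / (1 - x^2) = 2 * x^8 / (7 * (1 - x^2)^2)"
      using x2 by (simp add: divide_simps) algebra
    ultimately show "\<exists>y. (f has_real_derivative y) (at x) \<and> 0 \<le> y"
      by (intro exI[of _ "2 * x^8 / (7 * (1 - x^2)^2)"]) simp
  qed
  then show ?thesis using assms by (simp add: f_def ln_div)
qed

lemma arctan_upper:
  fixes a :: real
  assumes "0 \<le> a"
  shows "arctan a \<le> a - a^3 / 3 + a^5 / 5 - a^7 / 7 + a^9 / 9"
proof -
  define f where "f = (\<lambda>x::real. (x - x^3 / 3 + x^5 / 5 - x^7 / 7 + x^9 / 9) - arctan x)"
  have "f 0 \<le> f a"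
  proof (rule DERIV_nonneg_imp_nondecreasing[OF assms(1)])
    fix x assume x: "0 \<le> x" "x \<le> a"
    have p: "1 + x\<^sup>2 > 0" by (simp add: add_pos_nonneg)
    have "(f has_real_derivative ((1 - x^2 + x^4 - x^6 + x^8) - inverse (1 + x\<^sup>2))) (at x)"
      unfolding f_def using x assms by (auto intro!: derivative_eq_intros)
    moreover have "(1 - x^2 + x^4 - x^6 + x^8) - inverse (1 + x\<^sup>2) = x^10 / (1 + x^2)"
      using p by (simp add: field_simps)
    ultimately show "\<exists>y. (f has_real_derivative y) (at x) \<and> 0 \<le> y"
      using p by (intro exI[of _ "x^10 / (1 + x^2)"]) simp
  qed
  then show ?thesis using assms by (simp add: f_def)
qed

lemma arctan_lower:
  fixes a :: real
  assumes "0 \<le> a"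
  shows "a - a^3 / 3 \<le> arctan a"
proof -
  define f where "f = (\<lambda>x::real. arctan x - (x - x^3 / 3))"
  have "f 0 \<le> f a"
  proof (rule DERIV_nonneg_imp_nondecreasing[OF assms(1)])
    fix x assume x: "0 \<le> x" "x \<le> a"
    have p: "1 + x\<^sup>2 > 0" by (simp add: add_pos_nonneg)
    have "(f has_real_derivative (inverse (1 + x\<^sup>2) - (1 - x^2))) (at x)"
      unfolding f_def using x assms by (auto intro!: derivative_eq_intros)
    moreover have "inverse (1 + x\<^sup>2) - (1 - x^2) = x^4 / (1 + x^2)"
      using p by (simp add: field_simps)
    ultimately show "\<exists>y. (f has_real_derivative y) (at x) \<and> 0 \<le> y"
      using p by (intro exI[of _ "x^4 / (1 + x^2)"]) simp
  qed
  then show ?thesis using assms by (simp add: f_def)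
qed

text \<open>Inside the disc y^2 < \<rho>^2 - x^2, so cosh y is below exp((\<rho>^2 - x^2)/2) and
  only x remains. The monotonicity in t rests on t \<le> t + \<delta> \<le> tan (t + \<delta>). In
  the applications x is an imaginary part and y a real part.\<close>

lemma cosh_cos_disc:
  fixes x y \<rho> \<delta> :: real
  assumes xy: "x\<^sup>2 + y\<^sup>2 < \<rho>\<^sup>2" and \<rho>: "0 < \<rho>" and \<delta>: "0 \<le> \<delta>" "\<rho> + \<delta> < pi / 2"
  shows "cosh y * cos (\<rho> + \<delta>) < cos (x + \<delta>)"
proof -
  have "x\<^sup>2 < \<rho>\<^sup>2" using xy zero_le_power2[of y] by linarith
  then have x: "\<bar>x\<bar> < \<rho>" using \<rho> using power2_less_imp_less[of "\<bar>x\<bar>" \<rho>] by simp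
  have "(\<lambda>t. cos (t + \<delta>) * exp (t\<^sup>2 / 2)) \<bar>x\<bar> \<ge> (\<lambda>t. cos (t + \<delta>) * exp (t\<^sup>2 / 2)) \<rho>"
  proof (rule DERIV_nonpos_imp_nonincreasing[where a = "\<bar>x\<bar>" and b = \<rho>])
    fix t assume t: "\<bar>x\<bar> \<le> t" "t \<le> \<rho>"
    have d: "((\<lambda>t. cos (t + \<delta>) * exp (t\<^sup>2 / 2)) has_real_derivative
        (t * cos (t + \<delta>) - sin (t + \<delta>)) * exp (t\<^sup>2 / 2)) (at t)"
      by (auto intro!: derivative_eq_intros simp: algebra_simps)
    have c: "0 < cos (t + \<delta>)" using t \<delta> x by (intro cos_gt_zero_pi) auto
    have "t \<le> t + \<delta>" using \<delta> by simp
    also have "t + \<delta> \<le> tan (t + \<delta>)"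
      using arctan_le_self[of "tan (t + \<delta>)"] tan_pos_pi2_le[of "t + \<delta>"] t \<delta> x \<rho> by (simp add: arctan_tan)
    finally have "t * cos (t + \<delta>) - sin (t + \<delta>) \<le> 0"
      using c by (simp add: tan_def field_simps)
    with d show "\<exists>y. ((\<lambda>t. cos (t + \<delta>) * exp (t\<^sup>2 / 2)) has_real_derivative y) (at t) \<and> y \<le> 0"
      by (meson exp_ge_zero mult_nonpos_nonneg)
  qed (use x in simp)
  then have *: "cos (\<rho> + \<delta>) * exp (\<rho>\<^sup>2 / 2) \<le> cos (\<bar>x\<bar> + \<delta>) * exp (x\<^sup>2 / 2)"
    by simp
  have 1: "cos (\<rho> + \<delta>) * exp ((\<rho>\<^sup>2 - x\<^sup>2) / 2) \<le> cos (\<bar>x\<bar> + \<delta>)"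
  proof -
    have "exp ((\<rho>\<^sup>2 - x\<^sup>2) / 2) * exp (x\<^sup>2 / 2) = exp (\<rho>\<^sup>2 / 2)"
      by (simp flip: exp_add add: diff_divide_distrib)
    then have "cos (\<rho> + \<delta>) * exp ((\<rho>\<^sup>2 - x\<^sup>2) / 2) * exp (x\<^sup>2 / 2) \<le> cos (\<bar>x\<bar> + \<delta>) * exp (x\<^sup>2 / 2)"
      using * by (simp add: mult.assoc)
    then show ?thesis by simp
  qed
  have c: "0 < cos (\<rho> + \<delta>)" using \<rho> \<delta> by (intro cos_gt_zero_pi) auto
  have "cosh y < exp ((\<rho>\<^sup>2 - x\<^sup>2) / 2)"
    using cosh_le_exp_half_square[of y] xy
    by (intro order.strict_trans1[OF cosh_le_exp_half_square]) simp
  then have "cosh y * cos (\<rho> + \<delta>) < exp ((\<rho>\<^sup>2 - x\<^sup>2) / 2) * cos (\<rho> + \<delta>)"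
    using c by (rule mult_strict_right_mono)
  also have "\<dots> \<le> cos (\<bar>x\<bar> + \<delta>)" using 1 by (simp add: mult.commute)
  finally have "cosh y * cos (\<rho> + \<delta>) < cos (\<bar>x\<bar> + \<delta>)" .
  \<comment> \<open>As \<delta> is nonnegative, a positive x is the worse sign.\<close>
  moreover have "cos (\<bar>x\<bar> + \<delta>) \<le> cos \<bar>x + \<delta>\<bar>"
    using x \<rho> \<delta> by (intro cos_monotone_0_pi_le) auto
  ultimately show ?thesis by simp
qed

section \<open>Subordination as a condition on images of discs\<close>

definition bs_fun :: "real \<Rightarrow> complex \<Rightarrow> complex" where
  "bs_fun \<alpha> z = z / (1 - of_real \<alpha> * z\<^sup>2)"

text \<open>For positive \<open>\<alpha>\<close> and \<open>H\<close>, the positive root of \<alpha>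
  H r^2 + r - H = 0, that is, of F(r) = H. The radii \<open>r0\<close>, \<open>r1\<close>,
  \<open>r2\<close> are its values at \<open>h1\<close>, \<open>h2\<close>,
  \<open>k1 + k0\<close>.\<close>

definition bs_radius :: "real \<Rightarrow> real \<Rightarrow> real" where
  "bs_radius \<alpha> H = (- 1 + sqrt (1 + 4 * \<alpha> * H\<^sup>2)) / (2 * \<alpha> * H)"

text \<open>The extra condition for a radius below 1 says H < 1/(1 - \<alpha>) = F(1).\<close>

lemma bs_radius:
  assumes "0 < \<alpha>" "0 < H"
  shows bs_radius_pos: "0 < bs_radius \<alpha> H"
    and bs_radius_eq: "bs_radius \<alpha> H = H * (1 - \<alpha> * (bs_radius \<alpha> H)\<^sup>2)"
    and bs_radius_less_1: "H * (1 - \<alpha>) < 1 \<Longrightarrow> bs_radius \<alpha> H < 1"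
proof -
  define s where "s = sqrt (1 + 4 * \<alpha> * H\<^sup>2)"
  define r where "r = bs_radius \<alpha> H"
  have s2: "s\<^sup>2 = 1 + 4 * \<alpha> * H\<^sup>2" using assms by (simp add: s_def)
  have s1: "1 < s" unfolding s_def using assms by simp
  have r: "s = 1 + r * (2 * \<alpha> * H)"
    using assms by (simp add: r_def bs_radius_def s_def field_simps)
  have "r = (s - 1) / (2 * \<alpha> * H)" by (simp add: r_def bs_radius_def s_def)
  then show 0: "0 < bs_radius \<alpha> H" using s1 assms by (simp add: r_def)
  have "(1 + r * (2 * \<alpha> * H))\<^sup>2 = 1 + 4 * \<alpha> * H\<^sup>2" using s2 r by simp
  then have "4 * \<alpha> * H * (\<alpha> * H * r\<^sup>2 + r - H) = 0" by algebra
  then have eq: "\<alpha> * H * r\<^sup>2 + r - H = 0" using assms by simp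
  then show "bs_radius \<alpha> H = H * (1 - \<alpha> * (bs_radius \<alpha> H)\<^sup>2)"
    unfolding r_def by (simp add: algebra_simps)
  show "bs_radius \<alpha> H < 1" if "H * (1 - \<alpha>) < 1"
  proof (rule ccontr)
    assume "\<not> bs_radius \<alpha> H < 1"
    then have "1 \<le> r" by (simp add: r_def)
    then have "\<alpha> * H * 1 \<le> \<alpha> * H * r\<^sup>2" using assms by (intro mult_left_mono) auto
    with eq \<open>1 \<le> r\<close> that show False by (simp add: algebra_simps)
  qed
qed

lemma bs_denom_nonzero:
  assumes "0 < \<alpha>" "\<alpha> < 1" "norm z < 1"
  shows "1 - complex_of_real \<alpha> * z\<^sup>2 \<noteq> 0"
proof
  assume "1 - complex_of_real \<alpha> * z\<^sup>2 = 0"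
  then have "norm (complex_of_real \<alpha> * z\<^sup>2) = 1" by simp
  moreover have "norm (complex_of_real \<alpha> * z\<^sup>2) = \<alpha> * (norm z)\<^sup>2"
    using assms by (simp add: norm_mult norm_power)
  moreover have "\<alpha> * (norm z)\<^sup>2 \<le> \<alpha> * 1"
    using assms by (intro mult_left_mono) (auto simp: abs_square_le_1)
  ultimately show False using assms by simp
qed

lemma bs_fun_holomorphic:
  assumes "0 < \<alpha>" "\<alpha> < 1"
  shows "bs_fun \<alpha> holomorphic_on ball 0 1"
  unfolding bs_fun_def using bs_denom_nonzero[OF assms]
  by (auto intro!: holomorphic_intros)

text \<open>From |1 - \<alpha> z^2| \<ge> 1 - \<alpha> |z|^2: on a circle about 0 the modulus of F
  is largest at the positive real point, where it equals H if the radius is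
  \<open>bs_radius \<alpha> H\<close>.\<close>

lemma norm_bs_fun_le:
  assumes "0 < \<alpha>" "0 < H" "H * (1 - \<alpha>) < 1" "norm z \<le> bs_radius \<alpha> H"
  shows "norm (bs_fun \<alpha> z) \<le> H"
    and "norm z < bs_radius \<alpha> H \<Longrightarrow> norm (bs_fun \<alpha> z) < H"
proof -
  define r where "r = bs_radius \<alpha> H"
  have r: "0 < r" "r = H * (1 - \<alpha> * r\<^sup>2)"
    using bs_radius[OF assms(1,2)] by (auto simp: r_def)
  have d: "1 - \<alpha> * (norm z)\<^sup>2 \<le> norm (1 - complex_of_real \<alpha> * z\<^sup>2)"
    using norm_triangle_ineq2[of 1 "complex_of_real \<alpha> * z\<^sup>2"] assms
    by (simp add: norm_mult norm_power)
  have p: "0 < 1 - \<alpha> * r\<^sup>2" using r assms(2) by (metis zero_less_mult_pos)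
  have z2: "\<alpha> * (norm z)\<^sup>2 \<le> \<alpha> * r\<^sup>2"
    using assms by (intro mult_left_mono power_mono) (auto simp: r_def)
  have D: "0 < norm (1 - complex_of_real \<alpha> * z\<^sup>2)" using d p z2 by linarith
  have le: "H * (1 - \<alpha> * r\<^sup>2) \<le> H * norm (1 - complex_of_real \<alpha> * z\<^sup>2)"
    using d z2 assms(2) by (intro mult_left_mono) linarith+
  have "norm z \<le> H * norm (1 - complex_of_real \<alpha> * z\<^sup>2)" using le r assms(4) by (simp add: r_def)
  then show "norm (bs_fun \<alpha> z) \<le> H"
    using D by (simp add: bs_fun_def norm_divide pos_divide_le_eq)
  show "norm (bs_fun \<alpha> z) < H" if "norm z < bs_radius \<alpha> H"
  proof -
    have "norm z < H * norm (1 - complex_of_real \<alpha> * z\<^sup>2)" using le r that by (simp add: r_def)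
    then show ?thesis using D by (simp add: bs_fun_def norm_divide pos_divide_less_eq)
  qed
qed

lemma bs_fun_bs_radius:
  assumes "0 < \<alpha>" "0 < H"
  shows "bs_fun \<alpha> (of_real (bs_radius \<alpha> H)) = of_real H"
proof -
  define r where "r = bs_radius \<alpha> H"
  have r: "0 < r" "r = H * (1 - \<alpha> * r\<^sup>2)"
    using bs_radius[OF assms(1,2)] by (auto simp: r_def)
  have p: "0 < 1 - \<alpha> * r\<^sup>2" using r assms(2) by (metis zero_less_mult_pos)
  have "r / (1 - \<alpha> * r\<^sup>2) = H" using p r(2) by (simp add: divide_eq_eq)
  then have "complex_of_real (r / (1 - \<alpha> * r\<^sup>2)) = of_real H" by (rule arg_cong)
  then show ?thesis unfolding bs_fun_def r_def[symmetric] by simp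
qed

section \<open>The function psi and its explicit inverse\<close>

lemma one_plus_mult_Re_pos:
  fixes A z :: complex
  assumes "norm A < 1" "norm z < 1"
  shows "0 < Re (1 + A * z)"
proof -
  have "norm (A * z) < 1"
    using assms mult_left_mono[of "norm z" 1 "norm A"] by (simp add: norm_mult)
  then show ?thesis using abs_Re_le_cmod[of "A * z"] by simp
qed

lemma psi_holomorphic:
  assumes "norm A < 1" "norm B < 1"
  shows "psi A B holomorphic_on ball 0 1"
proof -
  have "(1 + A * z) / (1 + B * z) \<notin> \<real>\<^sub>\<le>\<^sub>0" if "norm z < 1" for z
  proof
    assume "(1 + A * z) / (1 + B * z) \<in> \<real>\<^sub>\<le>\<^sub>0"
    then obtain s where s: "s \<le> 0" "(1 + A * z) / (1 + B * z) = complex_of_real s"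
      by (auto elim!: nonpos_Reals_cases)
    have B: "0 < Re (1 + B * z)" and A: "0 < Re (1 + A * z)"
      using one_plus_mult_Re_pos assms that by blast+
    then have "1 + B * z \<noteq> 0" by force
    with s have "1 + A * z = complex_of_real s * (1 + B * z)" by (simp add: divide_eq_eq)
    then have "Re (1 + A * z) = s * Re (1 + B * z)"
      by (metis Re_complex_of_real Im_complex_of_real mult_zero_left diff_zero times_complex.simps(1))
    also have "\<dots> \<le> 0" using s(1) B by (intro mult_nonpos_nonneg) auto
    finally show False using A by linarith
  qed
  moreover have "1 + B * z \<noteq> 0" if "norm z < 1" for z
    using one_plus_mult_Re_pos[OF assms(2) that] by force
  ultimately show ?thesis unfolding psi_def
    by (auto intro!: holomorphic_intros)
qed

text \<open>The bound by pi puts (A - B) w on the principal branch, so that \<open>Ln\<close> undoes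
  \<open>exp\<close>.\<close>

lemma psi_inverse:
  assumes "A \<noteq> B" "\<bar>Im ((A - B) * w)\<bar> < pi"
    and "A - B * exp ((A - B) * w) \<noteq> 0"
  shows "psi A B ((exp ((A - B) * w) - 1) / (A - B * exp ((A - B) * w))) = w"
proof -
  define E where "E = exp ((A - B) * w)"
  define D where "D = A - B * E"
  have D: "D \<noteq> 0" using assms by (simp add: D_def E_def)
  have "1 + A * ((E - 1) / D) = (A - B) * E / D" "1 + B * ((E - 1) / D) = (A - B) / D"
    using D by (simp_all add: field_simps) (simp_all add: D_def algebra_simps)
  then have "(1 + A * ((E - 1) / D)) / (1 + B * ((E - 1) / D)) = E"
    using D assms(1) by simp
  moreover have "Ln E = (A - B) * w"
    unfolding E_def using assms by (intro Ln_exp) auto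
  ultimately have "psi A B ((E - 1) / D) = w" using assms(1) by (simp add: psi_def)
  then show ?thesis by (simp add: D_def E_def)
qed

text \<open>The quotient of E - 1 by A - B E is z itself, because both are multiples of (A - B)/(1 +
  B z).\<close>

lemma psi_image:
  assumes "norm A < 1" "norm B < 1" "A \<noteq> B" "norm z < 1" "w = psi A B z"
  shows "norm (exp ((A - B) * w) - 1) < norm (A - B * exp ((A - B) * w))"
proof -
  have B: "1 + B * z \<noteq> 0" and A: "1 + A * z \<noteq> 0"
    using one_plus_mult_Re_pos[OF assms(2,4)] one_plus_mult_Re_pos[OF assms(1,4)] by force+
  define E where "E = exp ((A - B) * w)"
  have E: "E = (1 + A * z) / (1 + B * z)"
    using A B assms(3) by (simp add: E_def assms(5) psi_def)
  have 1: "E - 1 = z * ((A - B) / (1 + B * z))" and 2: "A - B * E = (A - B) / (1 + B * z)"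
    using B by (simp_all add: E field_simps)
  have "norm (E - 1) = norm z * norm (A - B * E)" unfolding 1 2 by (rule norm_mult)
  also have "\<dots> < 1 * norm (A - B * E)"
    using assms B by (intro mult_strict_right_mono) (auto simp: 2)
  finally show ?thesis by (simp add: E_def)
qed

section \<open>Criteria for membership and for sharpness\<close>

lemma starlike_expr_rescale:
  assumes f: "f \<in> class_A" and \<rho>: "0 < \<rho>" "\<rho> \<le> 1"
  defines "g \<equiv> (\<lambda>z. f (of_real \<rho> * z) / of_real \<rho>)"
  shows "g \<in> class_A"
    and "\<And>z. norm z < 1 \<Longrightarrow> starlike_expr g z = starlike_expr f (of_real \<rho> * z)"
proof -
  have holf: "f holomorphic_on ball 0 1" and f0: "f 0 = 0" and f1: "deriv f 0 = 1"
    using f by (auto simp: class_A_def)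
  have sc: "norm (complex_of_real \<rho> * z) < 1" if "norm z < 1" for z
    using that \<rho> mult_le_one[of \<rho> "norm z"] mult_right_mono[of \<rho> 1 "norm z"]
    by (simp add: norm_mult)
  have d: "deriv g z = deriv f (of_real \<rho> * z)" if "norm z < 1" for z
  proof -
    have "(f has_field_derivative deriv f (of_real \<rho> * z)) (at (of_real \<rho> * z))"
      using holf sc[OF that] by (intro holomorphic_derivI[of _ "ball 0 1"]) auto
    then have "(g has_field_derivative deriv f (of_real \<rho> * z)) (at z)"
      unfolding g_def using \<rho>
      by (auto intro!: derivative_eq_intros DERIV_chain2[where f = f])
    then show ?thesis by (rule DERIV_imp_deriv)
  qed
  have "g holomorphic_on ball 0 1"
    unfolding g_def using \<rho> sc
    by (auto intro!: holomorphic_intros holomorphic_on_compose_gen[OF _ holf, unfolded o_def])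
  then show "g \<in> class_A" using d[of 0] f0 f1 by (auto simp: class_A_def g_def)
  show "starlike_expr g z = starlike_expr f (of_real \<rho> * z)" if "norm z < 1" for z
    using d[OF that] \<rho> by (simp add: starlike_expr_def g_def)
qed

text \<open>After rescaling, the Schwarz lemma confines the arguments of F to the disc of radius
  \<rho>. The required Schwarz function is the explicit inverse of psi applied to the rescaled
  expression; the strict inequality gives both its nonzero denominator and its bound by 1.\<close>

lemma BS_in_F_radiusI:
  assumes \<alpha>: "0 < \<alpha>" "\<alpha> < 1" and AB: "norm A < 1" "norm B < 1" "A \<noteq> B"
    and \<rho>: "0 < \<rho>" "\<rho> \<le> 1"
    and im: "\<And>z. norm z < \<rho> \<Longrightarrow> \<bar>Im ((A - B) * bs_fun \<alpha> z)\<bar> < pi"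
    and less: "\<And>z. norm z < \<rho> \<Longrightarrow>
      norm (exp ((A - B) * bs_fun \<alpha> z) - 1) < norm (A - B * exp ((A - B) * bs_fun \<alpha> z))"
  shows "BS_in_F_radius \<alpha> A B \<rho>"
  unfolding BS_in_F_radius_def in_F_on_disc_def
proof
  fix f assume "f \<in> class_BS \<alpha>"
  then have f: "f \<in> class_A" and sub: "subordinate (starlike_expr f) (bs_fun \<alpha>)"
    by (auto simp: class_BS_def bs_fun_def[abs_def])
  from sub obtain \<omega> where \<omega>: "\<omega> holomorphic_on ball 0 1" "\<omega> 0 = 0"
      "\<And>z. norm z < 1 \<Longrightarrow> norm (\<omega> z) < 1"
      and eq: "\<And>z. norm z < 1 \<Longrightarrow> starlike_expr f z = bs_fun \<alpha> (\<omega> z)"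
    and hol: "starlike_expr f holomorphic_on ball 0 1"
    by (auto simp: subordinate_def schwarz_function_def)
  define g where "g = (\<lambda>z. f (of_real \<rho> * z) / of_real \<rho>)"
  have g: "g \<in> class_A" "\<And>z. norm z < 1 \<Longrightarrow> starlike_expr g z = starlike_expr f (of_real \<rho> * z)"
    using starlike_expr_rescale[OF f \<rho>] by (auto simp: g_def)
  have sc: "norm (complex_of_real \<rho> * z) < \<rho>" if "norm z < 1" for z
    using that \<rho> by (simp add: norm_mult)
  have sc1: "norm (complex_of_real \<rho> * z) < 1" if "norm z < 1" for z
    using sc[OF that] \<rho> by simp
  define u where "u = (\<lambda>z. starlike_expr f (of_real \<rho> * z))"
  have holu: "u holomorphic_on ball 0 1"
    unfolding u_def using sc1
    by (auto intro!: holomorphic_intros holomorphic_on_compose_gen[OF _ hol, unfolded o_def])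
  have u: "\<exists>v. norm v < \<rho> \<and> u z = bs_fun \<alpha> v" if "norm z < 1" for z
  proof (intro exI conjI)
    show "u z = bs_fun \<alpha> (\<omega> (of_real \<rho> * z))" using eq sc1[OF that] by (simp add: u_def)
    have "norm (\<omega> (of_real \<rho> * z)) \<le> norm (complex_of_real \<rho> * z)"
      using Schwarz_Lemma(1)[OF \<omega> sc1[OF that]] by auto
    then show "norm (\<omega> (of_real \<rho> * z)) < \<rho>" using sc[OF that] by simp
  qed
  define \<Omega> where "\<Omega> = (\<lambda>z. (exp ((A - B) * u z) - 1) / (A - B * exp ((A - B) * u z)))"
  have ne: "A - B * exp ((A - B) * u z) \<noteq> 0" if "norm z < 1" for z
    using u[OF that] less by (metis norm_ge_zero norm_zero not_less)
  have "\<Omega> holomorphic_on ball 0 1"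
    unfolding \<Omega>_def using holu ne by (auto intro!: holomorphic_intros)
  moreover have "\<Omega> 0 = 0" by (simp add: \<Omega>_def u_def starlike_expr_def)
  moreover have "norm (\<Omega> z) < 1" if "norm z < 1" for z
  proof -
    from u[OF that] obtain v where "norm v < \<rho>" "u z = bs_fun \<alpha> v" by blast
    then show ?thesis using less[of v] ne[OF that]
      by (simp add: \<Omega>_def norm_divide divide_less_eq_1)
  qed
  moreover have "starlike_expr g z = psi A B (\<Omega> z)" if "norm z < 1" for z
  proof -
    from u[OF that] obtain v where v: "norm v < \<rho>" "u z = bs_fun \<alpha> v" by blast
    then have "psi A B (\<Omega> z) = u z"
      unfolding \<Omega>_def using im[of v] ne[OF that] AB by (intro psi_inverse) auto
    then show ?thesis using g(2)[OF that] by (simp add: u_def)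
  qed
  moreover have "starlike_expr g holomorphic_on ball 0 1"
    using holu by (rule holomorphic_transform) (simp add: g(2) u_def)
  ultimately have "subordinate (starlike_expr g) (psi A B)"
    using psi_holomorphic AB unfolding subordinate_def schwarz_function_def
    by auto
  then show "(\<lambda>z. f (of_real \<rho> * z) / of_real \<rho>) \<in> class_F A B"
    using g(1) by (simp add: class_F_def g_def)
qed

text \<open>Solving z f'/f - 1 = F gives f = z exp(G) with G' = F(z)/z = 1/(1 - \<alpha> z^2), hence
  G(z) = artanh(b z)/b with b = sqrt \<alpha>. Positive real parts keep both logarithms on the
  principal branch.\<close>

lemma extremal_BS:
  assumes \<alpha>: "0 < \<alpha>" "\<alpha> < 1"
  obtains f where "f \<in> class_BS \<alpha>" "\<And>z. norm z < 1 \<Longrightarrow> starlike_expr f z = bs_fun \<alpha> z"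
proof -
  define b where "b = sqrt \<alpha>"
  have b: "0 < b" "b < 1" "b\<^sup>2 = \<alpha>" using \<alpha> by (auto simp: b_def)
  define G where "G = (\<lambda>z. (Ln (1 + of_real b * z) - Ln (1 + (- of_real b) * z)) / (2 * of_real b))"
  define f where "f = (\<lambda>z::complex. z * exp (G z))"
  have pos: "0 < Re (1 + of_real b * z)" "0 < Re (1 + (- of_real b) * z)" if "norm z < 1" for z
    by (rule one_plus_mult_Re_pos; use that b in simp)+
  have dLn: "((\<lambda>z. Ln (1 + c * z)) has_field_derivative c / (1 + c * z)) (at z)"
    if "1 + c * z \<notin> \<real>\<^sub>\<le>\<^sub>0" for c z
    using that by (auto intro!: derivative_eq_intros simp: divide_inverse)
  have dG: "(G has_field_derivative 1 / (1 - of_real \<alpha> * z\<^sup>2)) (at z)" if "norm z < 1" for z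
  proof -
    have np: "1 + of_real b * z \<notin> \<real>\<^sub>\<le>\<^sub>0" "1 + (- of_real b) * z \<notin> \<real>\<^sub>\<le>\<^sub>0"
      using pos[OF that] by (auto simp: complex_nonpos_Reals_iff)
    then have nz: "1 + of_real b * z \<noteq> 0" "1 + (- of_real b) * z \<noteq> 0" by auto
    have "(G has_field_derivative
       (of_real b / (1 + of_real b * z) - (- of_real b) / (1 + (- of_real b) * z)) / (2 * of_real b)) (at z)"
      unfolding G_def using np by (intro DERIV_cdivide DERIV_diff dLn)
    moreover have "(of_real b / (1 + of_real b * z) - (- of_real b) / (1 + (- of_real b) * z)) / (2 * of_real b)
        = 1 / ((1 + of_real b * z) * (1 + (- of_real b) * z))"
      using nz b by (simp add: divide_simps) (simp add: algebra_simps)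
    moreover have "(1 + of_real b * z) * (1 + (- of_real b) * z) = 1 - of_real \<alpha> * z\<^sup>2"
      unfolding b(3)[symmetric] by (simp add: algebra_simps power2_eq_square)
    ultimately show ?thesis by simp
  qed
  have df: "(f has_field_derivative exp (G z) * (1 + bs_fun \<alpha> z)) (at z)" if "norm z < 1" for z
    unfolding f_def bs_fun_def
    by (auto intro!: derivative_eq_intros dG[OF that] simp: algebra_simps)
  have "f holomorphic_on ball 0 1"
    using df by (intro holomorphic_onI) (auto simp: field_differentiable_def intro: has_field_derivative_at_within)
  moreover have "deriv f 0 = 1"
    using DERIV_imp_deriv[OF df[of 0]] by (simp add: bs_fun_def G_def)
  ultimately have fA: "f \<in> class_A" by (simp add: class_A_def f_def)
  have st: "starlike_expr f z = bs_fun \<alpha> z" if "norm z < 1" for z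
    using DERIV_imp_deriv[OF df[OF that]]
    by (simp add: starlike_expr_def f_def bs_fun_def)
  have "starlike_expr f holomorphic_on ball 0 1"
    using bs_fun_holomorphic[OF \<alpha>] by (rule holomorphic_transform) (simp add: st)
  moreover have "schwarz_function (\<lambda>z. z)" by (simp add: schwarz_function_def)
  ultimately have "subordinate (starlike_expr f) (bs_fun \<alpha>)"
    using st bs_fun_holomorphic[OF \<alpha>] unfolding subordinate_def by auto
  then have "f \<in> class_BS \<alpha>" using fA by (simp add: class_BS_def bs_fun_def[abs_def])
  with st that show ?thesis by blast
qed

text \<open>For a radius \<rho> > r the point r/\<rho> lies in the open unit disc, so the extremal
  function would place F(r) in the open range of psi, against \<open>psi_image\<close>.\<close>

lemma sharp_BS_in_F_radiusI:
  assumes \<alpha>: "0 < \<alpha>" "\<alpha> < 1" and AB: "norm A < 1" "norm B < 1" "A \<noteq> B"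
    and r: "0 < r" 
    and ge: "norm (exp ((A - B) * bs_fun \<alpha> (of_real r)) - 1)
      \<ge> norm (A - B * exp ((A - B) * bs_fun \<alpha> (of_real r)))"
  shows "sharp_BS_in_F_radius \<alpha> A B r"
  unfolding sharp_BS_in_F_radius_def
proof (intro allI impI notI)
  fix \<rho> assume \<rho>: "r < \<rho> \<and> \<rho> \<le> 1" and B: "BS_in_F_radius \<alpha> A B \<rho>"
  obtain f where f: "f \<in> class_BS \<alpha>" "\<And>z. norm z < 1 \<Longrightarrow> starlike_expr f z = bs_fun \<alpha> z"
    using extremal_BS[OF \<alpha>] by blast
  then have fA: "f \<in> class_A" by (simp add: class_BS_def)
  define z where "z = complex_of_real (r / \<rho>)"
  have z: "norm z < 1" "of_real \<rho> * z = of_real r" using \<rho> r unfolding z_def norm_of_real by auto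
  have "(\<lambda>z. f (of_real \<rho> * z) / of_real \<rho>) \<in> class_F A B"
    using B f(1) by (simp add: BS_in_F_radius_def in_F_on_disc_def)
  then obtain \<omega> where "\<And>z. norm z < 1 \<Longrightarrow> norm (\<omega> z) < 1"
    "\<And>z. norm z < 1 \<Longrightarrow> starlike_expr (\<lambda>z. f (of_real \<rho> * z) / of_real \<rho>) z = psi A B (\<omega> z)"
    unfolding class_F_def subordinate_def schwarz_function_def mem_Collect_eq by (metis mem_ball_0)
  with z(1) have \<omega>: "norm (\<omega> z) < 1"
    "starlike_expr (\<lambda>z. f (of_real \<rho> * z) / of_real \<rho>) z = psi A B (\<omega> z)" by blast+
  have "starlike_expr (\<lambda>z. f (of_real \<rho> * z) / of_real \<rho>) z = starlike_expr f (of_real \<rho> * z)"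
    using \<rho> r z by (intro starlike_expr_rescale[OF fA]) auto
  also have "\<dots> = bs_fun \<alpha> (of_real r)" using f(2) z \<rho> r by simp
  finally have "bs_fun \<alpha> (of_real r) = psi A B (\<omega> z)" using \<omega>(2) by simp
  from psi_image[OF AB \<omega>(1) this] ge show False by simp
qed

section \<open>The range of psi in real coordinates\<close>

lemma cmod_diff_power2: "(norm (z - w))\<^sup>2 = (norm z)\<^sup>2 + (norm w)\<^sup>2 - 2 * Re (cnj z * w)"
  unfolding cmod_power2 by (simp add: power2_eq_square algebra_simps)

text \<open>Since |A| = |B|, the terms 1 and exp(2 p) carry the same coefficient \<alpha>^2 - 1;
  together they form a multiple of exp(p) cosh p, and the factor exp(p) comes out.\<close>

lemma cmod_psi_region:
  assumes A: "norm A = \<alpha>" and B: "norm B = \<alpha>"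
  shows "(norm (A - B * exp (Complex p q)))\<^sup>2 - (norm (exp (Complex p q) - 1))\<^sup>2
    = 2 * exp p * (Re ((1 - cnj A * B) * cis q) - (1 - \<alpha>\<^sup>2) * cosh p)"
proof -
  define e where "e = exp p"
  have e: "exp (Complex p q) = of_real e * cis q" by (simp add: exp_eq_polar e_def)
  have ch: "2 * e * cosh p = 1 + e\<^sup>2"
    by (simp add: e_def cosh_field_def exp_minus field_simps power2_eq_square)
  have 1: "(norm (A - B * (of_real e * cis q)))\<^sup>2 = \<alpha>\<^sup>2 + \<alpha>\<^sup>2 * e\<^sup>2 - 2 * (e * Re (cnj A * B * cis q))"
    unfolding cmod_diff_power2[of A] by (simp add: norm_mult A B power_mult_distrib algebra_simps)
  have 2: "(norm (of_real e * cis q - 1))\<^sup>2 = 1 + e\<^sup>2 - 2 * (e * Re (cis q))"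
    unfolding norm_minus_commute[of _ 1] cmod_diff_power2[of 1] by (simp add: norm_mult)
  have "(norm (A - B * (of_real e * cis q)))\<^sup>2 - (norm (of_real e * cis q - 1))\<^sup>2
    = 2 * e * Re ((1 - cnj A * B) * cis q) - (1 - \<alpha>\<^sup>2) * (1 + e\<^sup>2)"
    unfolding 1 2 by (simp add: algebra_simps)
  also have "\<dots> = 2 * e * (Re ((1 - cnj A * B) * cis q) - (1 - \<alpha>\<^sup>2) * cosh p)"
    unfolding ch[symmetric] by (simp add: algebra_simps)
  finally show ?thesis by (simp add: e e_def)
qed

section \<open>Round discs in the range of psi\<close>

lemma psi_region_iff:
  assumes A: "norm A = \<alpha>" and B: "norm B = \<alpha>"
  shows "norm (exp v - 1) < norm (A - B * exp v) \<longleftrightarrow>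
      (1 - \<alpha>\<^sup>2) * cosh (Re v) < Re ((1 - cnj A * B) * cis (Im v))"
    and "norm (exp v - 1) \<le> norm (A - B * exp v) \<longleftrightarrow>
      (1 - \<alpha>\<^sup>2) * cosh (Re v) \<le> Re ((1 - cnj A * B) * cis (Im v))"
    and "norm (exp v - 1) = norm (A - B * exp v) \<longleftrightarrow>
      (1 - \<alpha>\<^sup>2) * cosh (Re v) = Re ((1 - cnj A * B) * cis (Im v))"
proof -
  define d where "d = Re ((1 - cnj A * B) * cis (Im v)) - (1 - \<alpha>\<^sup>2) * cosh (Re v)"
  have *: "(norm (A - B * exp v))\<^sup>2 - (norm (exp v - 1))\<^sup>2 = 2 * exp (Re v) * d"
    using cmod_psi_region[OF A B, of "Re v" "Im v"] by (simp only: d_def complex_surj)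
  have sq: "x < y \<longleftrightarrow> 0 < y\<^sup>2 - x\<^sup>2" "x \<le> y \<longleftrightarrow> 0 \<le> y\<^sup>2 - x\<^sup>2" "x = y \<longleftrightarrow> 0 = y\<^sup>2 - x\<^sup>2"
    if "0 \<le> x" "0 \<le> y" for x y :: real
    using that by (auto intro: power_strict_mono power_mono
        dest: power2_less_imp_less power2_le_imp_le power2_eq_imp_eq)
  have "norm (exp v - 1) < norm (A - B * exp v) \<longleftrightarrow> 0 < 2 * exp (Re v) * d"
    unfolding *[symmetric] by (intro sq) auto
  then show "norm (exp v - 1) < norm (A - B * exp v) \<longleftrightarrow>
      (1 - \<alpha>\<^sup>2) * cosh (Re v) < Re ((1 - cnj A * B) * cis (Im v))"
    by (simp add: d_def zero_less_mult_iff)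
  have "norm (exp v - 1) \<le> norm (A - B * exp v) \<longleftrightarrow> 0 \<le> 2 * exp (Re v) * d"
    unfolding *[symmetric] by (intro sq) auto
  then show "norm (exp v - 1) \<le> norm (A - B * exp v) \<longleftrightarrow>
      (1 - \<alpha>\<^sup>2) * cosh (Re v) \<le> Re ((1 - cnj A * B) * cis (Im v))"
    by (simp add: d_def zero_le_mult_iff)
  have "norm (exp v - 1) = norm (A - B * exp v) \<longleftrightarrow> 0 = 2 * exp (Re v) * d"
    unfolding *[symmetric] by (intro sq) auto
  then show "norm (exp v - 1) = norm (A - B * exp v) \<longleftrightarrow>
      (1 - \<alpha>\<^sup>2) * cosh (Re v) = Re ((1 - cnj A * B) * cis (Im v))"
    by (auto simp: d_def)
qed

text \<open>The polar form N cis \<delta> turns the region into (1 - \<alpha>^2) cosh p < N cos(q +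
  \<delta>). The second equation in \<open>N\<close> says that i \<rho> is a boundary point; by
  \<open>cosh_cos_disc\<close> no boundary point is nearer to 0.\<close>

lemma disc_in_psi_region:
  assumes A: "norm A = \<alpha>" and B: "norm B = \<alpha>" and \<alpha>: "0 < \<alpha>" "\<alpha> < 1"
    and N: "1 - cnj A * B = of_real N * cis \<delta>" "1 - \<alpha>\<^sup>2 = N * cos (\<rho> + \<delta>)"
    and \<rho>: "0 < \<rho>" "0 \<le> \<delta>" "\<rho> + \<delta> < pi / 2"
  shows "norm v < \<rho> \<Longrightarrow> norm (exp v - 1) < norm (A - B * exp v)"
    and "norm (exp (\<i> * of_real \<rho>) - 1) = norm (A - B * exp (\<i> * of_real \<rho>))"
proof -
  have c: "0 < cos (\<rho> + \<delta>)" using \<rho> by (intro cos_gt_zero_pi) auto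
  have "0 < 1 - \<alpha>\<^sup>2" using \<alpha> by (simp add: abs_square_less_1)
  then have N0: "0 < N" using N(2) c by (metis zero_less_mult_pos2)
  have Re: "Re ((1 - cnj A * B) * cis q) = N * cos (q + \<delta>)" for q
    unfolding N(1) by (simp add: mult.assoc cis_mult add.commute)
  show "norm (exp v - 1) < norm (A - B * exp v)" if "norm v < \<rho>"
  proof -
    have "(norm v)\<^sup>2 < \<rho>\<^sup>2" using that by (intro power_strict_mono) auto
    then have "(Im v)\<^sup>2 + (Re v)\<^sup>2 < \<rho>\<^sup>2" by (simp add: cmod_power2)
    from cosh_cos_disc[OF this \<rho>(1,2,3)]
    have "N * (cosh (Re v) * cos (\<rho> + \<delta>)) < N * cos (Im v + \<delta>)" using N0 by simp
    then show ?thesis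
      unfolding psi_region_iff[OF A B] Re N(2) by (simp add: mult.assoc mult.commute mult.left_commute)
  qed
  show "norm (exp (\<i> * of_real \<rho>) - 1) = norm (A - B * exp (\<i> * of_real \<rho>))"
    unfolding psi_region_iff[OF A B] Re N(2) by simp
qed

text \<open>Division by |A - B| carries the disc to the w-plane, where its radius is H. Sharpness
  needs A - B on the positive imaginary axis: only then does the real value F(r) = H go to the
  boundary point i \<rho>.\<close>

lemma BS_in_F_radius_disc:
  assumes A: "norm A = \<alpha>" and B: "norm B = \<alpha>" and \<alpha>: "0 < \<alpha>" "\<alpha> < 1"
    and N: "1 - cnj A * B = of_real N * cis \<delta>" "1 - \<alpha>\<^sup>2 = N * cos (\<rho> + \<delta>)"
    and \<rho>: "0 < \<rho>" "0 \<le> \<delta>" "\<rho> + \<delta> < pi / 2"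
    and H: "norm (A - B) * H = \<rho>" "H \<le> 1"
  shows "0 < bs_radius \<alpha> H" "bs_radius \<alpha> H < 1" "BS_in_F_radius \<alpha> A B (bs_radius \<alpha> H)"
    and "A - B = \<i> * of_real (norm (A - B)) \<Longrightarrow> sharp_BS_in_F_radius \<alpha> A B (bs_radius \<alpha> H)"
proof -
  have AB: "A \<noteq> B" using H(1) \<rho>(1) by auto
  have H0: "0 < H" using H(1) \<rho>(1) by (metis norm_ge_zero zero_less_mult_pos mult_eq_0_iff order_less_le)
  have "H * (1 - \<alpha>) \<le> 1 * (1 - \<alpha>)" using H(2) \<alpha> by (intro mult_right_mono) auto
  then have "H * (1 - \<alpha>) < 1" by (rule order.strict_trans1) (use \<alpha> in simp)
  note r = bs_radius_pos[OF \<alpha>(1) H0] bs_radius_less_1[OF \<alpha>(1) H0 this]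
    and F = norm_bs_fun_le(2)[OF \<alpha>(1) H0 this less_imp_le]
  show "0 < bs_radius \<alpha> H" "bs_radius \<alpha> H < 1" by (fact r)+
  have small: "norm ((A - B) * bs_fun \<alpha> z) < \<rho>" if "norm z < bs_radius \<alpha> H" for z
  proof -
    have "norm (A - B) * norm (bs_fun \<alpha> z) < norm (A - B) * H"
      using F that AB by (intro mult_strict_left_mono) auto
    then show ?thesis by (simp add: norm_mult H)
  qed
  show "BS_in_F_radius \<alpha> A B (bs_radius \<alpha> H)"
  proof (rule BS_in_F_radiusI)
    fix z :: complex assume "norm z < bs_radius \<alpha> H"
    note s = small[OF this]
    show "\<bar>Im ((A - B) * bs_fun \<alpha> z)\<bar> < pi"
      using s abs_Im_le_cmod[of "(A - B) * bs_fun \<alpha> z"] \<rho> by linarith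
    show "norm (exp ((A - B) * bs_fun \<alpha> z) - 1) < norm (A - B * exp ((A - B) * bs_fun \<alpha> z))"
      by (rule disc_in_psi_region(1)[OF A B \<alpha> N \<rho> s])
  qed (use A B \<alpha> AB r in auto)
  show "sharp_BS_in_F_radius \<alpha> A B (bs_radius \<alpha> H)" if AB': "A - B = \<i> * of_real (norm (A - B))"
  proof (rule sharp_BS_in_F_radiusI)
    have "(A - B) * bs_fun \<alpha> (of_real (bs_radius \<alpha> H)) = \<i> * of_real (norm (A - B) * H)"
      unfolding bs_fun_bs_radius[OF \<alpha>(1) H0] by (subst AB') simp
    then show "norm (A - B * exp ((A - B) * bs_fun \<alpha> (of_real (bs_radius \<alpha> H))))
      \<le> norm (exp ((A - B) * bs_fun \<alpha> (of_real (bs_radius \<alpha> H))) - 1)"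
      using disc_in_psi_region(2)[OF A B \<alpha> N \<rho>] by (simp add: H)
  qed (use A B \<alpha> AB r in auto)
qed

text \<open>The double angle 2 arctan \<alpha> has the required sine, and it stays within the
  principal range because arctan \<alpha> < pi/4.\<close>

lemma h2_eq:
  assumes "0 < \<alpha>" "\<alpha> < 1"
  shows "h2 \<alpha> = arctan \<alpha> / \<alpha>"
proof -
  have "arctan \<alpha> < pi / 4" using arctan_monotone[of \<alpha> 1] assms by (simp add: arctan_one)
  moreover have "0 < arctan \<alpha>" using assms by simp
  moreover have "sin (2 * arctan \<alpha>) = 2 * \<alpha> / (1 + \<alpha>\<^sup>2)"
    by (simp add: sin_double sin_arctan cos_arctan add_nonneg_nonneg)
  moreover from calculation(2) have "- (pi / 2) \<le> 2 * arctan \<alpha>" using pi_gt_zero by linarith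
  ultimately have "arcsin (2 * \<alpha> / (1 + \<alpha>\<^sup>2)) = 2 * arctan \<alpha>"
    using arcsin_sin[of "2 * arctan \<alpha>"] by simp
  then show ?thesis by (simp add: h2_def)
qed

text \<open>Here 1 - cnj A * B = 1 + \<alpha>^2 is real, so \<delta> = 0, and the boundary equation
  cos \<rho> = (1 - \<alpha>^2)/(1 + \<alpha>^2) has the solution \<rho> = 2 arctan \<alpha> = 2
  \<alpha> h2.\<close>

lemma r1_BS_in_F:
  assumes \<alpha>: "0 < \<alpha>" "\<alpha> < 1"
  shows "0 < r1 \<alpha>" "r1 \<alpha> < 1"
    "BS_in_F_radius \<alpha> (complex_of_real \<alpha>) (- complex_of_real \<alpha>) (r1 \<alpha>)"
proof -
  have r: "r1 \<alpha> = bs_radius \<alpha> (h2 \<alpha>)" by (simp add: r1_def bs_radius_def)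
  have b: "0 < arctan \<alpha>" "arctan \<alpha> < pi / 4" "arctan \<alpha> \<le> \<alpha>"
    using arctan_monotone[of \<alpha> 1] arctan_le_self[of \<alpha>] \<alpha> by (auto simp: arctan_one)
  have p: "0 < 1 + \<alpha>\<^sup>2" by (simp add: add_pos_nonneg)
  have c: "(1 + \<alpha>\<^sup>2) * cos (2 * arctan \<alpha>) = 1 - \<alpha>\<^sup>2"
    using p by (simp add: cos_double cos_arctan sin_arctan power_divide diff_divide_eq_iff flip: diff_divide_distrib)
  have n: "norm (complex_of_real \<alpha> - - complex_of_real \<alpha>) = 2 * \<alpha>"
    using \<alpha> by (simp flip: of_real_add)
  note * = BS_in_F_radius_disc[of "complex_of_real \<alpha>" \<alpha> "- complex_of_real \<alpha>" "1 + \<alpha>\<^sup>2" 0 "2 * arctan \<alpha>" "h2 \<alpha>",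
      folded r]
  show "0 < r1 \<alpha>" by (rule *) (use \<alpha> b c n in \<open>auto simp: h2_eq power2_eq_square\<close>)
  show "r1 \<alpha> < 1" by (rule *) (use \<alpha> b c n in \<open>auto simp: h2_eq power2_eq_square\<close>)
  show "BS_in_F_radius \<alpha> (complex_of_real \<alpha>) (- complex_of_real \<alpha>) (r1 \<alpha>)"
    by (rule *) (use \<alpha> b c n in \<open>auto simp: h2_eq power2_eq_square\<close>)
qed

text \<open>The number 1 - cnj A * B = c + i d has modulus N and argument \<delta>, and cos \<sigma>
  = (1 - \<alpha>^2)/N, so the boundary point sits at \<rho> = \<sigma> - \<delta>. With |A - B| =
  s, \<open>k1\<close> is \<sigma>/s and \<open>k0\<close> is - \<delta>/s.\<close>

lemma r2_BS_in_F:
  assumes \<alpha>: "0 < \<alpha>" "\<alpha> < 1" and \<gamma>: "0 < \<gamma>" "\<gamma> \<le> pi / 2"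
  defines "A \<equiv> complex_of_real \<alpha> * cis \<gamma>" and "B \<equiv> complex_of_real \<alpha> * cis (- \<gamma>)"
  shows "0 < r2 \<alpha> \<gamma>" "r2 \<alpha> \<gamma> < 1" "BS_in_F_radius \<alpha> A B (r2 \<alpha> \<gamma>)"
    "sharp_BS_in_F_radius \<alpha> A B (r2 \<alpha> \<gamma>)"
proof -
  define s where "s = 2 * \<alpha> * sin \<gamma>"
  define N where "N = sqrt (1 + \<alpha>^4 - 2 * \<alpha>\<^sup>2 * cos (2 * \<gamma>))"
  define c where "c = 1 - \<alpha>\<^sup>2 * cos (2 * \<gamma>)"
  define d where "d = \<alpha>\<^sup>2 * sin (2 * \<gamma>)"
  define \<sigma> where "\<sigma> = arcsin (s / N)"
  define \<delta> where "\<delta> = arctan (d / c)"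
  define H where "H = k1 \<alpha> \<gamma> + k0 \<alpha> \<gamma>"
  have sin0: "0 < sin \<gamma>" using \<gamma> by (intro sin_gt_zero) auto
  have cos0: "0 \<le> cos \<gamma>" using \<gamma> by (intro cos_ge_zero) auto
  have s0: "0 < s" using sin0 \<alpha> by (simp add: s_def)
  have a2: "\<alpha>\<^sup>2 < 1" using \<alpha> by (simp add: abs_square_less_1)
  have "\<alpha>\<^sup>2 * cos (2 * \<gamma>) \<le> \<alpha>\<^sup>2 * 1" by (intro mult_left_mono) auto
  then have c0: "0 < c" using a2 by (simp add: c_def)
  have d0: "0 \<le> d" using sin0 cos0 by (simp add: d_def sin_double)
  have N2': "1 + \<alpha>^4 - 2 * \<alpha>\<^sup>2 * cos (2 * \<gamma>) = (1 - \<alpha>\<^sup>2)\<^sup>2 + s\<^sup>2"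
    unfolding cos_double_sin s_def by algebra
  have N0: "0 < N" unfolding N_def N2' using s0 by (simp add: add_nonneg_pos)
  have N2: "N\<^sup>2 = (1 - \<alpha>\<^sup>2)\<^sup>2 + s\<^sup>2" unfolding N_def N2' by simp
  have N3: "N\<^sup>2 = c\<^sup>2 + d\<^sup>2"
    unfolding N2 c_def d_def s_def cos_double sin_double using sin_cos_squared_add[of \<gamma>] by algebra
  have "sqrt (1 + (d / c)\<^sup>2) = N / c"
  proof (rule real_sqrt_unique)
    show "(N / c)\<^sup>2 = 1 + (d / c)\<^sup>2" using c0 by (simp add: power_divide N3 field_simps)
  qed (use N0 c0 in simp)
  then have cosd: "cos \<delta> = c / N" and sind: "sin \<delta> = d / N"
    using c0 by (simp_all add: \<delta>_def cos_arctan sin_arctan)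
  have "s < N" by (rule power2_less_imp_less) (use N2 N0 a2 in auto)
  then have sN: "0 < s / N" "s / N < 1" using s0 N0 by auto
  have "sqrt (1 - (s / N)\<^sup>2) = (1 - \<alpha>\<^sup>2) / N"
  proof (rule real_sqrt_unique)
    show "((1 - \<alpha>\<^sup>2) / N)\<^sup>2 = 1 - (s / N)\<^sup>2"
    proof -
      have "(1 - \<alpha>\<^sup>2)\<^sup>2 = N\<^sup>2 - s\<^sup>2" using N2 by simp
      then have "((1 - \<alpha>\<^sup>2) / N)\<^sup>2 = (N\<^sup>2 - s\<^sup>2) / N\<^sup>2" by (simp only: power_divide)
      then show ?thesis using N0 by (simp add: diff_divide_distrib power_divide)
    qed
  qed (use N0 a2 in simp)
  then have cos\<sigma>: "cos \<sigma> = (1 - \<alpha>\<^sup>2) / N" and sin\<sigma>: "sin \<sigma> = s / N"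
    using sN by (simp_all add: \<sigma>_def cos_arcsin)
  have \<sigma>: "0 < \<sigma>" "\<sigma> < pi / 2"
    using arcsin_less_mono[of 0 "s / N"] arcsin_lt_bounded[of "s / N"] sN by (auto simp: \<sigma>_def)
  have \<delta>: "0 \<le> \<delta>" "\<delta> < pi / 2" using d0 c0 arctan_ubound[of "d / c"] unfolding \<delta>_def by auto
  \<comment> \<open>The tangent of arg(1 + A). Indeed \<sigma> - \<delta> = 2 arg(1 + A), a form
    that shows 0 < \<sigma> - \<delta> \<le> s and hence 0 < H \<le> 1.\<close>
  define t where "t = \<alpha> * sin \<gamma> / (1 + \<alpha> * cos \<gamma>)"
  have ac: "1 \<le> 1 + \<alpha> * cos \<gamma>" using \<alpha> cos0 by simp
  have "\<alpha> * sin \<gamma> \<le> \<alpha> * 1" using \<alpha> by (intro mult_left_mono) auto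
  then have as: "\<alpha> * sin \<gamma> < 1" by (rule order.strict_trans1) (use \<alpha> in simp)
  have t: "0 < t" "t \<le> \<alpha> * sin \<gamma>"
    using ac \<alpha> sin0 mult_left_mono[of 1 "1 + \<alpha> * cos \<gamma>" "\<alpha> * sin \<gamma>"]
    by (auto simp: t_def divide_le_eq)
  have "\<sigma> - \<delta> = 2 * arctan t"
  proof (rule sin_inj_pi)
    have "arctan t < pi / 4" using arctan_monotone[of t 1] t as by (simp add: arctan_one)
    moreover have "0 < arctan t" using t by simp
    ultimately show "- (pi / 2) \<le> 2 * arctan t" "2 * arctan t \<le> pi / 2" using pi_gt_zero by linarith+
    show "- (pi / 2) \<le> \<sigma> - \<delta>" "\<sigma> - \<delta> \<le> pi / 2" using \<sigma> \<delta> by linarith+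
    have D: "0 < 1 + \<alpha>\<^sup>2 + 2 * \<alpha> * cos \<gamma>" using \<alpha> cos0 by (simp add: add_pos_nonneg)
    have "sin (\<sigma> - \<delta>) = (s * c - (1 - \<alpha>\<^sup>2) * d) / N\<^sup>2"
      by (simp only: sin_diff cosd sind cos\<sigma> sin\<sigma> times_divide_times_eq power2_eq_square[of N]
          diff_divide_distrib[symmetric])
    also have "\<dots> = s * (1 + \<alpha> * cos \<gamma>) / (1 + \<alpha>\<^sup>2 + 2 * \<alpha> * cos \<gamma>)"
    proof -
      have "(s * c - (1 - \<alpha>\<^sup>2) * d) * (1 + \<alpha>\<^sup>2 + 2 * \<alpha> * cos \<gamma>) = s * (1 + \<alpha> * cos \<gamma>) * N\<^sup>2"
        unfolding N2 c_def d_def s_def cos_double sin_double using sin_cos_squared_add[of \<gamma>] by algebra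
      then show ?thesis using D N0 by (simp add: frac_eq_eq)
    qed
    also have "\<dots> = 2 * t / (1 + t\<^sup>2)"
    proof -
      have "1 + t\<^sup>2 = (1 + \<alpha>\<^sup>2 + 2 * \<alpha> * cos \<gamma>) / (1 + \<alpha> * cos \<gamma>)\<^sup>2"
        unfolding t_def using ac
        by (simp add: power_divide add_divide_eq_iff frac_eq_eq)
          (use sin_cos_squared_add[of \<gamma>] in algebra)
      then show ?thesis unfolding t_def s_def using ac D by (simp add: power2_eq_square)
    qed
    also have "\<dots> = sin (2 * arctan t)"
      by (simp add: sin_double sin_arctan cos_arctan add_nonneg_nonneg)
    finally show "sin (\<sigma> - \<delta>) = sin (2 * arctan t)" .
  qed
  moreover have "0 < arctan t" "arctan t \<le> \<alpha> * sin \<gamma>" using arctan_le_self[of t] t by auto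
  ultimately have \<rho>: "0 < \<sigma> - \<delta>" "\<sigma> - \<delta> \<le> s" by (auto simp: s_def)
  have "d / (\<alpha>\<^sup>2 * cos (2 * \<gamma>) - 1) = - (d / c)" unfolding c_def by (metis minus_diff_eq divide_minus_right)
  then have H: "H = (\<sigma> - \<delta>) / s"
    by (simp add: H_def k1_def k0_def \<sigma>_def \<delta>_def s_def N_def arctan_minus diff_divide_distrib flip: d_def)
  have r: "r2 \<alpha> \<gamma> = bs_radius \<alpha> H" by (simp add: r2_def bs_radius_def H_def)
  have nA: "norm A = \<alpha>" and nB: "norm B = \<alpha>" using \<alpha> by (auto simp: A_def B_def norm_mult)
  have AB: "A - B = \<i> * of_real s"
    by (simp add: A_def B_def s_def complex_eq_iff)
  have nAB: "norm (A - B) = s" unfolding AB using s0 by (simp add: norm_mult)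
  have cc: "cnj A * B = of_real (\<alpha>\<^sup>2) * cis (- (2 * \<gamma>))"
    unfolding A_def B_def by (simp add: cis_cnj cis_mult power2_eq_square)
  have "1 - cnj A * B = of_real N * cis \<delta>"
    unfolding cc using N0 by (simp add: complex_eq_iff cosd sind c_def d_def)
  moreover have "1 - \<alpha>\<^sup>2 = N * cos (\<sigma> - \<delta> + \<delta>)" using N0 by (simp add: cos\<sigma>)
  moreover have "\<sigma> - \<delta> + \<delta> < pi / 2" using \<sigma> by simp
  moreover have "norm (A - B) * H = \<sigma> - \<delta>" "H \<le> 1" using \<rho> s0 by (auto simp: nAB H)
  moreover have "A - B = \<i> * of_real (norm (A - B))" by (subst nAB) (rule AB)
  ultimately show "0 < r2 \<alpha> \<gamma>" "r2 \<alpha> \<gamma> < 1" "BS_in_F_radius \<alpha> A B (r2 \<alpha> \<gamma>)"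
    "sharp_BS_in_F_radius \<alpha> A B (r2 \<alpha> \<gamma>)"
    unfolding r using BS_in_F_radius_disc[OF nA nB \<alpha> _ _ \<rho>(1) \<delta>(1)] by blast+
qed

section \<open>The threshold\<close>

lemma h1_bounds:
  assumes "0 < \<alpha>" "\<alpha> < 1"
  shows h1_lower: "1 + \<alpha>^2 / 3 + \<alpha>^4 / 5 + \<alpha>^6 / 7 \<le> h1 \<alpha>"
    and h1_upper: "h1 \<alpha> \<le> 1 + \<alpha>^2 / 3 + \<alpha>^4 / 5 + \<alpha>^6 / (7 * (1 - \<alpha>^2))"
proof -
  have a2: "0 < 1 - \<alpha>\<^sup>2" using assms by (simp add: abs_square_less_1)
  have h: "h1 \<alpha> = ln ((1 + \<alpha>) / (1 - \<alpha>)) / 2 / \<alpha>" by (simp add: h1_def)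
  have "\<alpha> * (1 + \<alpha>^2 / 3 + \<alpha>^4 / 5 + \<alpha>^6 / 7) = \<alpha> + \<alpha>^3 / 3 + \<alpha>^5 / 5 + \<alpha>^7 / 7"
    by (simp add: eval_nat_numeral algebra_simps)
  with artanh_lower[of \<alpha>] assms show "1 + \<alpha>^2 / 3 + \<alpha>^4 / 5 + \<alpha>^6 / 7 \<le> h1 \<alpha>"
    unfolding h by (subst pos_le_divide_eq) (auto simp: mult.commute)
  have "\<alpha> * (1 + \<alpha>^2 / 3 + \<alpha>^4 / 5 + \<alpha>^6 / (7 * (1 - \<alpha>^2)))
      = \<alpha> + \<alpha>^3 / 3 + \<alpha>^5 / 5 + \<alpha>^7 / (7 * (1 - \<alpha>^2))"
    by (simp add: eval_nat_numeral algebra_simps)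
  with artanh_upper[of \<alpha>] assms show "h1 \<alpha> \<le> 1 + \<alpha>^2 / 3 + \<alpha>^4 / 5 + \<alpha>^6 / (7 * (1 - \<alpha>^2))"
    unfolding h by (subst pos_divide_le_eq) (auto simp: mult.commute)
qed

lemma h1_ge_1:
  assumes "0 < \<alpha>" "\<alpha> < 1"
  shows "1 \<le> h1 \<alpha>"
proof -
  have "0 \<le> \<alpha>^2 / 3 + \<alpha>^4 / 5 + \<alpha>^6 / 7" by simp
  then show ?thesis using h1_lower[OF assms] by linarith
qed

text \<open>The series of \<open>h1\<close> is dominated by the geometric series 1/(1 - \<alpha>^2),
  which is below 1/(1 - \<alpha>). This gives r0 < 1.\<close>

lemma h1_mult_less_1:
  assumes "0 < \<alpha>" "\<alpha> < 1"
  shows "h1 \<alpha> * (1 - \<alpha>) < 1"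
proof -
  have a2: "0 < 1 - \<alpha>\<^sup>2" using assms by (simp add: abs_square_less_1)
  have p: "0 < \<alpha>\<^sup>2" "0 < \<alpha>^4" "0 < \<alpha>^6" using assms by auto
  have "\<alpha>^6 / (7 * (1 - \<alpha>^2)) \<le> \<alpha>^6 / (1 - \<alpha>^2)"
    using a2 by (intro divide_left_mono mult_pos_pos) auto
  then have "h1 \<alpha> \<le> 1 + \<alpha>^2 + \<alpha>^4 + \<alpha>^6 / (1 - \<alpha>^2)"
    using h1_upper[OF assms] p by linarith
  also have "\<dots> = 1 / (1 - \<alpha>\<^sup>2)" using a2 by (simp add: field_simps)
  also have "\<dots> < 1 / (1 - \<alpha>)"
    using assms a2 by (intro divide_strict_left_mono) (auto simp: power2_eq_square)
  finally show ?thesis using assms by (simp add: pos_less_divide_eq)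
qed

lemma h2_bounds:
  assumes "0 < \<alpha>" "\<alpha> < 1"
  shows h2_lower: "1 - \<alpha>^2 / 3 \<le> h2 \<alpha>"
    and h2_upper: "h2 \<alpha> \<le> 1 - \<alpha>^2 / 3 + \<alpha>^4 / 5 - \<alpha>^6 / 7 + \<alpha>^8 / 9"
proof -
  have "\<alpha> * (1 - \<alpha>^2 / 3) = \<alpha> - \<alpha>^3 / 3" by (simp add: eval_nat_numeral algebra_simps)
  with arctan_lower[of \<alpha>] assms show "1 - \<alpha>^2 / 3 \<le> h2 \<alpha>"
    unfolding h2_eq[OF assms] by (subst pos_le_divide_eq) (auto simp: mult.commute)
  have "\<alpha> * (1 - \<alpha>^2 / 3 + \<alpha>^4 / 5 - \<alpha>^6 / 7 + \<alpha>^8 / 9)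
      = \<alpha> - \<alpha>^3 / 3 + \<alpha>^5 / 5 - \<alpha>^7 / 7 + \<alpha>^9 / 9"
    by (simp add: eval_nat_numeral algebra_simps)
  with arctan_upper[of \<alpha>] assms show "h2 \<alpha> \<le> 1 - \<alpha>^2 / 3 + \<alpha>^4 / 5 - \<alpha>^6 / 7 + \<alpha>^8 / 9"
    unfolding h2_eq[OF assms] by (subst pos_divide_le_eq) (auto simp: mult.commute)
qed

lemma h2_pos: "0 < \<alpha> \<Longrightarrow> \<alpha> < 1 \<Longrightarrow> 0 < h2 \<alpha>"
  by (simp add: h2_eq)

lemma alpha_powers_le:
  fixes \<alpha> c :: real
  assumes "0 < \<alpha>" "\<alpha> \<le> c" "c < 1"
  shows "\<alpha>^2 \<le> c^2" "\<alpha>^4 \<le> c^4" "\<alpha>^6 / (7 * (1 - \<alpha>^2)) \<le> c^6 / (7 * (1 - c^2))"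
proof -
  show 1: "\<alpha>^2 \<le> c^2" "\<alpha>^4 \<le> c^4" using assms by (auto intro: power_mono)
  have "0 < 1 - c\<^sup>2" using assms by (simp add: abs_square_less_1)
  then show "\<alpha>^6 / (7 * (1 - \<alpha>^2)) \<le> c^6 / (7 * (1 - c^2))"
    using 1 assms by (intro frac_le) (auto intro: power_mono)
qed

lemma h1_le_mono:
  assumes "0 < \<alpha>" "\<alpha> \<le> c" "c < 1"
  shows "h1 \<alpha> \<le> 1 + c^2 / 3 + c^4 / 5 + c^6 / (7 * (1 - c^2))"
  using h1_upper[of \<alpha>] alpha_powers_le[OF assms] assms by linarith

lemma h1_le_half: "0 < \<alpha> \<Longrightarrow> \<alpha> \<le> 1 / 2 \<Longrightarrow> h1 \<alpha> \<le> 11 / 10"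
  using h1_le_mono[of \<alpha> "1/2"] by (simp add: power_divide)

lemma h1_le: "0 < \<alpha> \<Longrightarrow> \<alpha> \<le> 33 / 50 \<Longrightarrow> h1 \<alpha> \<le> 2409 / 2000"
  using h1_le_mono[of \<alpha> "33/50"] by (simp add: power_divide)

lemma h1_le_quadratic:
  assumes "0 < \<alpha>" "\<alpha> \<le> 33 / 50"
  shows "h1 \<alpha> \<le> 1 + \<alpha>\<^sup>2 / 2"
proof -
  have 2: "\<alpha>\<^sup>2 \<le> 11 / 25" using power_mono[of \<alpha> "33/50" 2] assms by (simp add: power_divide)
  have "\<alpha>\<^sup>2 * \<alpha>\<^sup>2 \<le> \<alpha>\<^sup>2 * (11 / 25)" by (rule mult_left_mono[OF 2]) simp
  then have 4: "\<alpha>^4 \<le> 11 / 25 * \<alpha>\<^sup>2" by (simp add: eval_nat_numeral)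
  have "\<alpha>^4 * \<alpha>\<^sup>2 \<le> \<alpha>^4 * (11 / 25)" by (rule mult_left_mono[OF 2]) simp
  then have 6: "\<alpha>^6 \<le> 11 / 25 * \<alpha>^4" by (simp add: eval_nat_numeral)
  have "\<alpha>^6 / (7 * (1 - \<alpha>\<^sup>2)) \<le> \<alpha>^6 / 3" using 2 by (intro divide_left_mono) auto
  then show ?thesis using h1_upper[of \<alpha>] 4 6 assms zero_le_power2[of \<alpha>] by linarith
qed

text \<open>With \<open>m = 4 \<alpha> h1\<^sup>2\<close> and \<open>u = sin\<^sup>2 \<theta>\<close>, the threshold equation is \<open>u (m\<^sup>2 u - alpha0_gap) = 0\<close>.\<close>
definition alpha0_gap :: "real \<Rightarrow> real" where
  "alpha0_gap \<alpha> = (h1 \<alpha> / h2 \<alpha>)\<^sup>2 * (1 + 4 * \<alpha> * (h1 \<alpha>)\<^sup>2) - (1 + 2 * (4 * \<alpha> * (h1 \<alpha>)\<^sup>2))"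

text \<open>With k = (h1/h2)^2 the gap is (k - 1)(1 + m) - m, where k - 1 is of order \<alpha>^2 but
  m \<ge> 4 \<alpha>. This keeps \<open>alpha0\<close> away from 0.\<close>

lemma alpha0_gap_small:
  assumes "0 < \<alpha>" "\<alpha> \<le> 1 / 10"
  shows "alpha0_gap \<alpha> \<le> 0"
proof -
  have a: "\<alpha> < 1" using assms by simp
  define x where "x = \<alpha>\<^sup>2"
  define m where "m = 4 * \<alpha> * (h1 \<alpha>)\<^sup>2"
  have x: "0 < x" "x \<le> \<alpha> / 10"
    using assms mult_left_mono[of \<alpha> "1/10" \<alpha>] by (auto simp: x_def power2_eq_square)
  then have x1: "x \<le> 1 / 100" using assms by linarith
  then have "x * x \<le> x * (1 / 100)" using x by (intro mult_left_mono) auto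
  then have "x\<^sup>2 \<le> x / 100" by (simp add: power2_eq_square)
  note x = x x1 this
  have h1: "h1 \<alpha> \<le> 1 + x / 2" using h1_le_quadratic[of \<alpha>] assms by (simp add: x_def)
  have h2: "1 - x / 3 \<le> h2 \<alpha>" using h2_lower[OF assms(1) a] by (simp add: x_def)
  have "(1 + x) * (1 - x / 3) = 1 + 2 * x / 3 - x\<^sup>2 / 3" by (simp add: field_simps power2_eq_square)
  then have "h1 \<alpha> \<le> (1 + x) * (1 - x / 3)" using h1 x by linarith
  also have "\<dots> \<le> (1 + x) * h2 \<alpha>" using h2 x by (intro mult_left_mono) auto
  finally have "h1 \<alpha> / h2 \<alpha> \<le> 1 + x" using h2_pos[OF assms(1) a] by (simp add: pos_divide_le_eq)
  moreover have "0 \<le> h1 \<alpha> / h2 \<alpha>" using h1_ge_1[OF assms(1) a] h2_pos[OF assms(1) a] by simp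
  ultimately have "(h1 \<alpha> / h2 \<alpha>)\<^sup>2 \<le> (1 + x)\<^sup>2" by (intro power_mono) auto
  also have "\<dots> \<le> 1 + 3 * x" using x by (simp add: power2_sum)
  finally have k: "(h1 \<alpha> / h2 \<alpha>)\<^sup>2 \<le> 1 + 3 * x" .
  have "1\<^sup>2 \<le> (h1 \<alpha>)\<^sup>2" "(h1 \<alpha>)\<^sup>2 \<le> (11/10)\<^sup>2"
    using h1 x h1_ge_1[OF assms(1) a] by (intro power_mono; simp)+
  then have m: "4 * \<alpha> \<le> m" "m \<le> 1"
    using assms mult_left_mono[of 1 "(h1 \<alpha>)\<^sup>2" "4 * \<alpha>"] mult_mono[of "4 * \<alpha>" "4/10" "(h1 \<alpha>)\<^sup>2" "121/100"]
    by (auto simp: m_def power_divide)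
  have K: "(h1 \<alpha> / h2 \<alpha>)\<^sup>2 * (1 + m) \<le> (1 + 3 * x) * (1 + m)"
    using k m assms by (intro mult_right_mono) auto
  have "3 * x * m \<le> 3 * x * 1" using x m by (intro mult_left_mono) auto
  moreover have "(1 + 3 * x) * (1 + m) = 1 + m + 3 * x + 3 * x * m" by (simp add: algebra_simps)
  ultimately have "(1 + 3 * x) * (1 + m) \<le> 1 + 2 * m" using x m by linarith
  with K show ?thesis by (simp add: alpha0_gap_def m_def)
qed

text \<open>Once (h1/h2)^2 \<ge> 9/5, the gap is positive as soon as m < 4. The factor 238/177 is
  the quotient of the bounds 119/100 and 177/200.\<close>

lemma alpha0_gap_pos: "0 < alpha0_gap (33 / 50)"
proof -
  define a :: real where "a = 33 / 50"
  define m where "m = 4 * a * (h1 a)\<^sup>2"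
  have a: "0 < a" "a < 1" by (auto simp: a_def)
  have h1: "119 / 100 \<le> h1 a" "h1 a \<le> 2409 / 2000" and h2: "h2 a \<le> 177 / 200"
    using h1_lower[OF a] h2_upper[OF a] h1_le[of a] by (auto simp: a_def power_divide)
  have "238 / 177 * h2 a \<le> h1 a" using h1 h2 by simp
  then have "238 / 177 \<le> h1 a / h2 a" using h2_pos[OF a] by (simp add: pos_le_divide_eq)
  then have "(238 / 177)\<^sup>2 \<le> (h1 a / h2 a)\<^sup>2" by (intro power_mono) auto
  then have k: "9 / 5 \<le> (h1 a / h2 a)\<^sup>2" by (simp add: power_divide)
  have "(h1 a)\<^sup>2 \<le> (2409 / 2000)\<^sup>2" using h1 by (intro power_mono) auto
  then have m: "0 \<le> m" "m \<le> 3.9" using a by (auto simp: m_def a_def power_divide)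
  have "9 / 5 * (1 + m) \<le> (h1 a / h2 a)\<^sup>2 * (1 + m)" using k m by (intro mult_right_mono) auto
  moreover have "1 + 2 * m < 9 / 5 * (1 + m)" using m by simp
  ultimately show ?thesis by (simp add: alpha0_gap_def m_def flip: a_def)
qed

text \<open>Adding 1 + 2 m to both sides gives (1 + m)^2 on the right, so the claim is (h1/h2)^2 < 1
  + m. Up to 33/50 the root u of the threshold equation is therefore always below 1, and a solution
  is simply a point of positive gap.\<close>

lemma alpha0_gap_less:
  assumes "0 < \<alpha>" "\<alpha> \<le> 33 / 50"
  shows "alpha0_gap \<alpha> < (4 * \<alpha> * (h1 \<alpha>)\<^sup>2)\<^sup>2"
proof -
  have a: "\<alpha> < 1" using assms by simp
  define x where "x = \<alpha>\<^sup>2"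
  define m where "m = 4 * \<alpha> * (h1 \<alpha>)\<^sup>2"
  have x: "0 < x" "x \<le> 33 / 50 * \<alpha>"
    using assms mult_left_mono[of \<alpha> "33/50" \<alpha>] by (auto simp: x_def power2_eq_square)
  then have x1: "x \<le> 0.44" using assms by simp
  note x = x x1
  have "1\<^sup>2 \<le> (h1 \<alpha>)\<^sup>2" using h1_ge_1[OF assms(1) a] by (intro power_mono) auto
  then have m: "4 * \<alpha> \<le> m" using assms mult_left_mono[of 1 "(h1 \<alpha>)\<^sup>2" "4 * \<alpha>"] by (auto simp: m_def)
  have xx: "x\<^sup>2 \<le> 0.44 * x" using x by (simp add: power2_eq_square)
  have h1: "h1 \<alpha> \<le> 1 + x / 2" using h1_le_quadratic[of \<alpha>] assms by (simp add: x_def)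
  have "h1 \<alpha> ^ 2 \<le> (1 + x / 2)\<^sup>2" using h1 h1_ge_1[OF assms(1) a] by (intro power_mono) auto
  also have "\<dots> \<le> 1 + 6 / 5 * x" using xx x by (simp add: power2_sum power_divide)
  finally have H: "(h1 \<alpha>)\<^sup>2 \<le> 1 + 6 / 5 * x" .
  have "(1 - x / 3)\<^sup>2 \<le> (h2 \<alpha>)\<^sup>2" using h2_lower[OF assms(1) a] x by (intro power_mono) (auto simp: x_def)
  moreover have "(1 - x / 3)\<^sup>2 = 1 - 2 * x / 3 + (x / 3)\<^sup>2" by (simp add: power2_diff)
  ultimately have h2: "1 - 2 * x / 3 \<le> (h2 \<alpha>)\<^sup>2" using zero_le_power2[of "x / 3"] by linarith
  have "1 + 6 / 5 * x < (1 - 2 * x / 3) * (1 + m)"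
  proof -
    have "2 * x / 3 * m \<le> 3 / 10 * m" using x m assms by (intro mult_right_mono) auto
    moreover have "(1 - 2 * x / 3) * (1 + m) = 1 + m - 2 * x / 3 - 2 * x / 3 * m" by (simp add: field_simps)
    ultimately show ?thesis using x m assms by linarith
  qed
  also have "\<dots> \<le> (h2 \<alpha>)\<^sup>2 * (1 + m)" using h2 m assms by (intro mult_right_mono) auto
  finally have "(h1 \<alpha> / h2 \<alpha>)\<^sup>2 < 1 + m"
    using H h2_pos[OF assms(1) a] by (simp add: power_divide pos_divide_less_eq mult.commute)
  then have "(h1 \<alpha> / h2 \<alpha>)\<^sup>2 * (1 + m) < (1 + m) * (1 + m)"
    using m assms by (intro mult_strict_right_mono) auto
  moreover have "(1 + m) * (1 + m) = 1 + 2 * m + m\<^sup>2" by (simp add: power2_eq_square algebra_simps)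
  ultimately show ?thesis unfolding alpha0_gap_def m_def[symmetric] by linarith
qed

lemma continuous_on_alpha0_gap: "continuous_on {0<..<1} alpha0_gap"
proof -
  have h1: "continuous_on {0<..<1} h1"
    unfolding h1_def by (intro continuous_intros) auto
  have "continuous_on {0<..<1} (\<lambda>\<alpha>::real. arctan \<alpha> / \<alpha>)"
    by (intro continuous_intros) auto
  then have h2: "continuous_on {0<..<1} h2"
    by (rule continuous_on_eq) (simp add: h2_eq)
  show ?thesis unfolding alpha0_gap_def
    by (intro continuous_intros h1 h2) (use h2_pos in force)
qed

text \<open>To be applied with \<open>n = 4 \<alpha> (Im z)\<^sup>2 / (1 - \<alpha> (r0 \<alpha>)\<^sup>2)\<^sup>2\<close> on the circle \<open>norm z = r0 \<alpha>\<close>.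
  For \<open>\<alpha> > 1 / 2\<close> the linear majorant of \<open>n / (1 + n)\<^sup>2\<close> is its tangent at \<open>n = 1 / 7\<close>.\<close>
lemma circle_estimate:
  fixes n :: real
  assumes \<alpha>: "0 < \<alpha>" "\<alpha> \<le> 33 / 50" and gap: "alpha0_gap \<alpha> \<le> 0" and n: "0 \<le> n"
  defines "m \<equiv> 4 * \<alpha> * (h1 \<alpha>)\<^sup>2"
  shows "(1 + m) * (1 + 2 / 9 * (\<alpha> * (1 + m) * n / (1 + n)\<^sup>2)) * ((1 + \<alpha>\<^sup>2) * h1 \<alpha>) \<le> 1 + 2 * m + m * n"
proof -
  have a: "\<alpha> < 1" using \<alpha> by simp
  define x where "x = \<alpha>\<^sup>2"
  define h where "h = h1 \<alpha>"
  define k where "k = n / (1 + n)\<^sup>2"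
  define g where "g = h2 \<alpha>"
  have h0: "1 \<le> h" using h1_ge_1[OF \<alpha>(1) a] by (simp add: h_def)
  have g0: "0 < g" using h2_pos[OF \<alpha>(1) a] by (simp add: g_def)
  have x0: "0 < x" "x \<le> (1089 / 2500)" using \<alpha> power_mono[of \<alpha> "33/50" 2] by (auto simp: x_def power_divide)
  have m0: "0 < m" using h0 \<alpha> by (simp add: m_def h_def[symmetric])
  have hm: "m = 4 * \<alpha> * h\<^sup>2" by (simp add: m_def h_def)
  have gap': "(h / g)\<^sup>2 * (1 + m) \<le> 1 + 2 * m" using gap by (simp add: alpha0_gap_def m_def h_def g_def)
  have al: "\<alpha>^4 = x^2" "\<alpha>^6 = x^3" "\<alpha>^8 = x^4" by (simp_all add: x_def flip: power_mult)
  have "1 + x / 3 + x\<^sup>2 / 5 + x^3 / 7 \<le> h"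
    using h1_lower[OF \<alpha>(1) a] unfolding h_def al x_def[symmetric] .
  moreover have "0 < x^3 / 7" using x0 by simp
  ultimately have hl: "1 + x / 3 + x\<^sup>2 / 5 \<le> h" by linarith
  have "x^4 \<le> x^3 * (1 / 2)" using x0 by (simp add: power_Suc2[of x 3, simplified])
  moreover have "g \<le> 1 - x / 3 + x\<^sup>2 / 5 - x^3 / 7 + x^4 / 9"
    using h2_upper[OF \<alpha>(1) a] unfolding g_def al x_def[symmetric] .
  ultimately have "g \<le> 1 - x / 3 + x\<^sup>2 / 5"
    using zero_less_power[OF x0(1), of 3] by linarith
  then have "g\<^sup>2 \<le> (1 - x / 3 + x\<^sup>2 / 5)\<^sup>2" using g0 by (intro power_mono) auto
  then have "(1 + x) * g\<^sup>2 \<le> (1 + x) * (1 - x / 3 + x\<^sup>2 / 5)\<^sup>2" using x0 by (intro mult_left_mono) auto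
  also have "\<dots> = 1 + x / 3 - 7/45 * x\<^sup>2 + 17/45 * x^3 - (7/75 - x / 25) * x^4"
    by (simp add: power2_eq_square eval_nat_numeral field_simps)
  also have "\<dots> \<le> 1 + x / 3 - 7/45 * x\<^sup>2 + 17/45 * x^3"
    using x0 by simp
  finally have gS: "(1 + x) * g\<^sup>2 \<le> 1 + x / 3 - 7/45 * x\<^sup>2 + 17/45 * x^3" .
  have hx: "1 + x / 3 \<le> h" using hl zero_le_power2[of x] by linarith
  have x3: "x^3 \<le> x\<^sup>2 * (1089 / 2500)" using x0 by (simp add: power_Suc2[of x 2, simplified])
  \<comment> \<open>A linear majorant t0 + t1 n of k makes the inequality linear in n.
    \<open>const\<close> handles the constant term, where the gap condition enters;
    \<open>slope\<close> handles the coefficient of n.\<close>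
  have main: ?thesis
    if k: "k \<le> t0 + t1 * n" and t: "0 \<le> t0" "0 \<le> t1"
      and slope: "t1 * ((1 + m)\<^sup>2 * (1 + x)) \<le> 18 * h"
      and const: "(1 + 2/9 * t0 * (\<alpha> * (1 + m))) * ((1 + x) * g\<^sup>2) \<le> h" for t0 t1
  proof -
    define P where "P = (1 + x) * h"
    have P0: "0 < P" using x0 h0 by (simp add: P_def)
    have "P * g\<^sup>2 * (1 + 2/9 * t0 * (\<alpha> * (1 + m))) \<le> h * h"
      using mult_left_mono[OF const, of h] h0 by (simp add: P_def algebra_simps)
    then have "P * (1 + 2/9 * t0 * (\<alpha> * (1 + m))) \<le> (h / g)\<^sup>2"
      using g0 by (simp add: power_divide pos_le_divide_eq power2_eq_square[of h] algebra_simps)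
    then have "P * (1 + 2/9 * t0 * (\<alpha> * (1 + m))) * (1 + m) \<le> (h / g)\<^sup>2 * (1 + m)"
      using m0 by (intro mult_right_mono) auto
    with gap' have c: "P * (1 + 2/9 * t0 * (\<alpha> * (1 + m))) * (1 + m) \<le> 1 + 2 * m" by simp
    have "2/9 * \<alpha> * h * (t1 * ((1 + m)\<^sup>2 * (1 + x))) \<le> 2/9 * \<alpha> * h * (18 * h)"
      using slope \<alpha> h0 by (intro mult_left_mono) auto
    moreover have "2/9 * \<alpha> * h * (18 * h) = m" by (simp add: hm power2_eq_square)
    moreover have "P * (2/9 * t1 * (\<alpha> * (1 + m))) * (1 + m) = 2/9 * \<alpha> * h * (t1 * ((1 + m)\<^sup>2 * (1 + x)))"
      by (simp add: P_def power2_eq_square)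
    ultimately have "P * (2/9 * t1 * (\<alpha> * (1 + m))) * (1 + m) \<le> m" by (simp only:)
    then have s: "P * (2/9 * t1 * (\<alpha> * (1 + m))) * (1 + m) * n \<le> m * n"
      using n by (intro mult_right_mono) auto
    have "(1 + m) * (1 + 2/9 * (\<alpha> * (1 + m) * k)) * P \<le> (1 + m) * (1 + 2/9 * (\<alpha> * (1 + m) * (t0 + t1 * n))) * P"
      using k P0 m0 \<alpha> by (intro mult_right_mono mult_left_mono add_left_mono) auto
    also have "\<dots> = P * (1 + 2/9 * t0 * (\<alpha> * (1 + m))) * (1 + m) + P * (2/9 * t1 * (\<alpha> * (1 + m))) * (1 + m) * n"
      by (simp add: field_simps)
    also have "\<dots> \<le> 1 + 2 * m + m * n" using c s by simp
    finally show ?thesis by (simp add: P_def k_def x_def h_def)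
  qed
  show ?thesis
  proof (cases "\<alpha> \<le> 1 / 2")
    case True
    have x1: "x \<le> 1 / 4" using \<alpha> True power_mono[of \<alpha> "1/2" 2] by (auto simp: x_def power_divide)
    have h1: "h \<le> 11 / 10" using h1_le_half[OF \<alpha>(1) True] by (simp add: h_def)
    have "h\<^sup>2 \<le> (11/10)\<^sup>2" using h0 h1 by (intro power_mono) auto
    then have hh: "h\<^sup>2 \<le> 121 / 100" by (simp add: power_divide)
    have "\<alpha> * h\<^sup>2 \<le> 1 / 2 * (121 / 100)" by (rule mult_mono[OF True hh]) simp_all
    then have "m \<le> 121 / 50" by (simp add: hm)
    then have "(1 + m)\<^sup>2 \<le> (171 / 50)\<^sup>2" using m0 by (intro power_mono) auto
    then have m2: "(1 + m)\<^sup>2 \<le> 12" by (simp add: power_divide)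
    have "(1 + m)\<^sup>2 * (1 + x) \<le> 12 * (5 / 4)" by (rule mult_mono[OF m2]) (use x0 x1 in simp_all)
    then have sl: "1 * ((1 + m)\<^sup>2 * (1 + x)) \<le> 18 * h" using h0 by simp
    have "(1 + x) * g\<^sup>2 \<le> h" using gS hl x3 zero_le_power2[of x] by linarith
    \<comment> \<open>The tangent at n = 0 costs nothing in the constant term. Its slope 1 is
      affordable only because (1 + m)^2 (1 + x) \<le> 15 here.\<close>
    moreover have "k \<le> 0 + 1 * n"
      using n divide_left_mono[of 1 "(1 + n)\<^sup>2" n] by (simp add: k_def)
    ultimately show ?thesis by (intro main[OF _ _ _ sl, of 0]) simp_all
  next
    case False
    have x1: "1 / 4 \<le> x" using False power_mono[of "1/2" \<alpha> 2] by (auto simp: x_def power_divide)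
    have h1: "h \<le> 2409 / 2000" using h1_le[OF \<alpha>] by (simp add: h_def)
    have "h\<^sup>2 \<le> (2409/2000)\<^sup>2" using h0 h1 by (intro power_mono) auto
    then have h2: "h\<^sup>2 \<le> 1451 / 1000" by (simp add: power_divide)
    have "\<alpha> * h\<^sup>2 \<le> 33 / 50 * (1451 / 1000)" by (rule mult_mono[OF \<alpha>(2) h2]) simp_all
    then have "m \<le> 3831 / 1000" by (simp add: hm power_divide)
    then have "(1 + m)\<^sup>2 \<le> (4831 / 1000)\<^sup>2" using m0 by (intro power_mono) auto
    then have m2: "(1 + m)\<^sup>2 \<le> 117 / 5" by (simp add: power_divide)
    have "(1 + m)\<^sup>2 * (1 + x) \<le> 117 / 5 * (359 / 250)" by (rule mult_mono[OF m2]) (use x0 x1 in simp_all)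
    then have "294/512 * ((1 + m)\<^sup>2 * (1 + x)) \<le> 294/512 * (117 / 5 * (359 / 250))" by (intro mult_left_mono) simp_all
    also have "\<dots> \<le> 18 * (1 + x / 3)" using x1 by simp
    also have "\<dots> \<le> 18 * h" using hx by (intro mult_left_mono) simp_all
    finally have sl: "294/512 * ((1 + m)\<^sup>2 * (1 + x)) \<le> 18 * h" .
    \<comment> \<open>The difference of the two sides below, with its double root at the point of
      tangency n = 1/7.\<close>
    have "0 \<le> (7 * n - 1)\<^sup>2 * (6 * n + 14)" using n by simp
    then have "512 * n \<le> (14 + 294 * n) * (1 + n)\<^sup>2" by (simp add: power2_eq_square algebra_simps)
    then have k: "k \<le> 14/512 + 294/512 * n" using n by (simp add: k_def pos_divide_le_eq field_simps)
    have "m \<le> (581 / 100) * \<alpha>" using \<alpha> mult_left_mono[OF h2, of "4 * \<alpha>"] by (simp add: hm)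
    then have "\<alpha> * m \<le> \<alpha> * ((581 / 100) * \<alpha>)" using \<alpha> by (intro mult_left_mono) auto
    moreover have "\<alpha> \<le> x + 1/4" using zero_le_power2[of "\<alpha> - 1/2"] by (simp add: x_def power2_diff power_divide)
    ultimately have am: "\<alpha> * (1 + m) \<le> 681 / 100 * x + 1 / 4" by (simp add: x_def power2_eq_square algebra_simps)
    define S where "S = (1 + x) * g\<^sup>2"
    have S0: "0 \<le> S" using x0 by (simp add: S_def)
    have xx: "x\<^sup>2 \<le> (1089 / 2500) * x" using x0 by (simp add: power2_eq_square)
    have S1: "S \<le> (23 / 20)" using gS x3 xx x0 by (simp add: S_def)
    \<comment> \<open>The price of the intercept 14/512. It must fit between \<open>gS\<close> and
      \<open>hl\<close>, which differ by (1/5 + 7/45) x^2 - 17/45 x^3.\<close>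
    have "2/9 * (14/512) * (\<alpha> * (1 + m)) \<le> 19 / 12500 + 207 / 5000 * x" using am x0 by simp
    then have "2/9 * (14/512) * (\<alpha> * (1 + m)) * S \<le> (19 / 12500 + 207 / 5000 * x) * (23 / 20)"
      by (rule mult_mono[OF _ S1]) (use S0 x0 in simp_all)
    also have "\<dots> \<le> 16/45 * x\<^sup>2 - 17/45 * x^3"
    proof -
      \<comment> \<open>On the interval from 1/4 to (33/50)^2 this bounds x^2 by its chord.\<close>
      have "0 \<le> (x - 1/4) * ((1089 / 2500) - x)" using x0 x1 by (intro mult_nonneg_nonneg) auto
      also have "\<dots> = 857 / 1250 * x - 1089 / 10000 - x\<^sup>2"
        by (simp add: field_simps power2_eq_square)
      finally have "16/45 * x - 17/45 * x\<^sup>2 \<ge> 3 / 50" using x1 by simp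
      then have "x * (16/45 * x - 17/45 * x\<^sup>2) \<ge> x * (3 / 50)" using x0 by (intro mult_left_mono) auto
      then show ?thesis using x1 by (simp add: algebra_simps power2_eq_square power3_eq_cube)
    qed
    finally have "2/9 * (14/512) * (\<alpha> * (1 + m)) * S \<le> 16/45 * x\<^sup>2 - 17/45 * x^3" .
    then have "S + 2/9 * (14/512) * (\<alpha> * (1 + m)) * S \<le> h"
      using gS hl unfolding S_def by linarith
    then have "(1 + 2/9 * (14/512) * (\<alpha> * (1 + m))) * ((1 + x) * g\<^sup>2) \<le> h"
      by (simp only: distrib_right S_def mult_1_left)
    from main[OF k _ _ sl this] show ?thesis by simp
  qed
qed

section \<open>The threshold equation and its infimum\<close>

lemma r0_eq: "r0 \<alpha> = bs_radius \<alpha> (h1 \<alpha>)"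
  by (simp add: r0_def bs_radius_def)

text \<open>The two fractions are (Re F)^2/h1^2 and (Im F)^2/h2^2 at the point r0 exp(i \<theta>).
  The vertex F(r0) = h1 accounts for the factor u = (sin \<theta>)^2; the other factor is linear in
  u.\<close>

lemma alpha0_equation_iff:
  assumes \<alpha>: "0 < \<alpha>" "\<alpha> < 1"
  shows "alpha0_equation \<alpha> \<theta> \<longleftrightarrow>
    sin \<theta> = 0 \<or> alpha0_gap \<alpha> = (4 * \<alpha> * (h1 \<alpha>)\<^sup>2)\<^sup>2 * (sin \<theta>)\<^sup>2"
proof -
  define h where "h = h1 \<alpha>"
  define g where "g = h2 \<alpha>"
  define r where "r = r0 \<alpha>"
  define q where "q = \<alpha> * r\<^sup>2"
  define m where "m = 4 * \<alpha> * h\<^sup>2"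
  define u where "u = (sin \<theta>)\<^sup>2"
  have h0: "0 < h" using h1_ge_1[OF \<alpha>] by (simp add: h_def)
  have g0: "0 < g" using h2_pos[OF \<alpha>] by (simp add: g_def)
  have r: "0 < r" "r = h * (1 - q)"
    using bs_radius_pos[OF \<alpha>(1) h0] bs_radius_eq[OF \<alpha>(1) h0] by (auto simp: r_def r0_eq h_def q_def)
  have q1: "0 < 1 - q" using r h0 by (metis zero_less_mult_pos)
  have r2: "r\<^sup>2 = h\<^sup>2 * (1 - q)\<^sup>2" by (subst r(2)) (simp add: power_mult_distrib)
  have "(1 - q)\<^sup>2 * m = 4 * \<alpha> * (h\<^sup>2 * (1 - q)\<^sup>2)" by (simp add: m_def)
  also have "\<dots> = 4 * q" unfolding r2[symmetric] by (simp add: q_def)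
  \<comment> \<open>Through this relation (1 - q)^2 factors out of the denominator and of (1 + q)^2,
    leaving m and u.\<close>
  finally have mq: "(1 - q)\<^sup>2 * m = 4 * q" .
  have m0: "0 < m" using \<alpha> h0 by (simp add: m_def)
  have M0: "0 < 1 + m * u" using m0 by (simp add: u_def add_pos_nonneg)
  have cos2: "(cos \<theta>)\<^sup>2 = 1 - u" by (simp add: u_def cos_squared_eq)
  have "1 + \<alpha>\<^sup>2 * r^4 - 2 * \<alpha> * r\<^sup>2 * cos (2 * \<theta>) = 1 + q\<^sup>2 - 2 * q * (1 - 2 * u)"
    by (simp add: q_def u_def cos_double_sin power_mult_distrib flip: power_mult)
  also have "\<dots> = (1 - q)\<^sup>2 * (1 + m * u)"
    using mq by algebra
  finally have D: "1 + \<alpha>\<^sup>2 * r^4 - 2 * \<alpha> * r\<^sup>2 * cos (2 * \<theta>) = (1 - q)\<^sup>2 * (1 + m * u)" .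
  have qp: "(1 + q)\<^sup>2 = (1 - q)\<^sup>2 * (1 + m)" using mq by algebra
  have t1: "r\<^sup>2 * (1 - u) * (1 - q)\<^sup>2 / (((1 - q)\<^sup>2 * (1 + m * u))\<^sup>2 * h\<^sup>2) = (1 - u) / (1 + m * u)\<^sup>2"
    unfolding r2 using q1 h0 by (simp add: power_mult_distrib) (simp add: power2_eq_square eval_nat_numeral)
  have t2: "r\<^sup>2 * u * (1 + q)\<^sup>2 / (((1 - q)\<^sup>2 * (1 + m * u))\<^sup>2 * g\<^sup>2) = (h / g)\<^sup>2 * u * (1 + m) / (1 + m * u)\<^sup>2"
    unfolding r2 qp using q1 g0 by (simp add: power_mult_distrib power_divide) (simp add: power2_eq_square eval_nat_numeral mult_ac)
  have "alpha0_equation \<alpha> \<theta> \<longleftrightarrow> 1 - (1 - u) / (1 + m * u)\<^sup>2 - (h / g)\<^sup>2 * u * (1 + m) / (1 + m * u)\<^sup>2 = 0"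
    unfolding alpha0_equation_def r_def[symmetric] h_def[symmetric] g_def[symmetric] D cos2
      u_def[symmetric] q_def[symmetric] t1 t2 ..
  also have "\<dots> \<longleftrightarrow> (1 + m * u)\<^sup>2 - (1 - u) - (h / g)\<^sup>2 * u * (1 + m) = 0"
  proof -
    have "1 - (1 - u) / (1 + m * u)\<^sup>2 - (h / g)\<^sup>2 * u * (1 + m) / (1 + m * u)\<^sup>2
      = ((1 + m * u)\<^sup>2 - (1 - u) - (h / g)\<^sup>2 * u * (1 + m)) / (1 + m * u)\<^sup>2"
      using M0 by (simp add: diff_divide_distrib)
    then show ?thesis using M0 by simp
  qed
  also have "(1 + m * u)\<^sup>2 - (1 - u) - (h / g)\<^sup>2 * u * (1 + m) = u * (m\<^sup>2 * u - alpha0_gap \<alpha>)"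
    unfolding alpha0_gap_def h_def[symmetric] g_def[symmetric] m_def[symmetric] by algebra
  finally show ?thesis by (auto simp: u_def m_def h_def)
qed

lemma alpha0_solutions_iff:
  "\<alpha> \<in> alpha0_solutions \<longleftrightarrow>
    0 < \<alpha> \<and> \<alpha> < 1 \<and> 0 < alpha0_gap \<alpha> \<and> alpha0_gap \<alpha> < (4 * \<alpha> * (h1 \<alpha>)\<^sup>2)\<^sup>2"
proof (cases "0 < \<alpha> \<and> \<alpha> < 1")
  case True
  then have \<alpha>: "0 < \<alpha>" "\<alpha> < 1" by auto
  define M where "M = (4 * \<alpha> * (h1 \<alpha>)\<^sup>2)\<^sup>2"
  have M: "0 < M" using \<alpha> h1_ge_1[OF \<alpha>] by (simp add: M_def)
  have "(\<exists>\<theta>. 0 < \<theta> \<and> \<theta> < pi / 2 \<and> alpha0_equation \<alpha> \<theta>) \<longleftrightarrow> 0 < alpha0_gap \<alpha> \<and> alpha0_gap \<alpha> < M"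
  proof (intro iffI conjI)
    assume "\<exists>\<theta>. 0 < \<theta> \<and> \<theta> < pi / 2 \<and> alpha0_equation \<alpha> \<theta>"
    then obtain \<theta> where \<theta>: "0 < \<theta>" "\<theta> < pi / 2" "alpha0_equation \<alpha> \<theta>" by blast
    have s: "0 < sin \<theta>" using \<theta> by (intro sin_gt_zero) auto
    have c: "0 < cos \<theta>" using \<theta> by (intro cos_gt_zero_pi) auto
    have eq: "alpha0_gap \<alpha> = M * (sin \<theta>)\<^sup>2" using \<theta>(3) s by (simp add: alpha0_equation_iff[OF \<alpha>] M_def)
    then show "0 < alpha0_gap \<alpha>" using s M by simp
    have "(sin \<theta>)\<^sup>2 < 1" using c by (simp add: sin_squared_eq)
    then show "alpha0_gap \<alpha> < M" using M unfolding eq by simp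
  next
    assume g: "0 < alpha0_gap \<alpha> \<and> alpha0_gap \<alpha> < M"
    \<comment> \<open>The root of the linear factor; it is the value of (sin \<theta>)^2 for the
      angle sought.\<close>
    define u where "u = alpha0_gap \<alpha> / M"
    have u: "0 < sqrt u" "sqrt u < 1" "0 \<le> u" using g M by (auto simp: u_def)
    define \<theta> where "\<theta> = arcsin (sqrt u)"
    have "0 < \<theta>" "\<theta> < pi / 2"
      using arcsin_less_mono[of 0 "sqrt u"] arcsin_lt_bounded[of "sqrt u"] u by (auto simp: \<theta>_def)
    moreover have "- 1 \<le> sqrt u" using u(1) by linarith
    then have "sin \<theta> = sqrt u" using u by (simp only: \<theta>_def sin_arcsin less_imp_le)
    then have "alpha0_gap \<alpha> = M * (sin \<theta>)\<^sup>2" using u M by (simp add: u_def)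
    then have "alpha0_equation \<alpha> \<theta>" by (simp add: alpha0_equation_iff[OF \<alpha>] M_def)
    ultimately show "\<exists>\<theta>. 0 < \<theta> \<and> \<theta> < pi / 2 \<and> alpha0_equation \<alpha> \<theta>" by blast
  qed
  then show ?thesis using \<alpha> by (simp add: alpha0_solutions_def M_def)
qed (auto simp: alpha0_solutions_def)

lemma alpha0_bounds: "1 / 10 \<le> alpha0" "alpha0 \<le> 33 / 50"
proof -
  have lower: "1 / 10 \<le> \<alpha>" if "\<alpha> \<in> alpha0_solutions" for \<alpha>
    using alpha0_gap_small[of \<alpha>] that by (fastforce simp: alpha0_solutions_iff)
  have mem: "33 / 50 \<in> alpha0_solutions"
    using alpha0_gap_pos alpha0_gap_less[of "33/50"] by (simp add: alpha0_solutions_iff)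
  then show "1 / 10 \<le> alpha0" unfolding alpha0_def using lower by (intro cInf_greatest) auto
  show "alpha0 \<le> 33 / 50" unfolding alpha0_def
    using lower by (intro cInf_lower[OF mem] bdd_belowI[of _ "1/10"]) auto
qed

text \<open>The case \<alpha> = \<open>alpha0\<close> requires an argument: a positive gap there
  would persist slightly to the left by continuity, and \<open>alpha0_gap_less\<close> would turn
  that into a solution below the infimum.\<close>

lemma alpha0_gap_nonpos:
  assumes "0 < \<alpha>" "\<alpha> \<le> alpha0"
  shows "alpha0_gap \<alpha> \<le> 0"
proof (rule ccontr)
  assume "\<not> alpha0_gap \<alpha> \<le> 0"
  then have pos: "0 < alpha0_gap \<alpha>" by simp
  have \<alpha>: "0 < \<alpha>" "\<alpha> < 1" using assms alpha0_bounds by auto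
  have "open ({0<..<1} \<inter> alpha0_gap -` {0<..})"
    using continuous_on_alpha0_gap by (intro continuous_open_preimage) auto
  moreover have "\<alpha> \<in> {0<..<1} \<inter> alpha0_gap -` {0<..}" using \<alpha> pos by auto
  ultimately obtain e where e: "0 < e" "ball \<alpha> e \<subseteq> {0<..<1} \<inter> alpha0_gap -` {0<..}"
    by (meson openE)
  have "\<alpha> - e / 2 \<in> ball \<alpha> e" using e(1) by (simp add: dist_real_def)
  with e(2) have "\<alpha> - e / 2 \<in> {0<..<1} \<inter> alpha0_gap -` {0<..}" by (rule subsetD)
  then have *: "0 < \<alpha> - e / 2" "0 < alpha0_gap (\<alpha> - e / 2)" by auto
  have "\<alpha> - e / 2 \<in> alpha0_solutions"
    using * \<alpha> e(1) assms alpha0_bounds alpha0_gap_less[of "\<alpha> - e / 2"] by (simp add: alpha0_solutions_iff)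
  moreover have "bdd_below alpha0_solutions"
    by (rule bdd_belowI[of _ 0]) (simp add: alpha0_solutions_iff)
  ultimately have "alpha0 \<le> \<alpha> - e / 2" unfolding alpha0_def by (rule cInf_lower)
  with assms e(1) show False by simp
qed

section \<open>The image of the circle of radius r0\<close>

text \<open>At P = 2 \<alpha> h1 one has cosh P = (1 + \<alpha>^2)/(1 - \<alpha>^2), so v = P is a
  boundary point. The bounds for cosh and cos reduce the claim to one between P^2 - (Re v)^2 and (Im
  v)^2. Both contain the factor \<alpha> n/w; dividing by it leaves
  \<open>circle_estimate\<close>.\<close>

lemma bs_circle_in_psi_region:
  assumes \<alpha>: "0 < \<alpha>" "\<alpha> \<le> 33 / 50" and gap: "alpha0_gap \<alpha> \<le> 0" and z: "norm z = r0 \<alpha>"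
  defines "v \<equiv> 2 * of_real \<alpha> * bs_fun \<alpha> z"
  shows "(1 - \<alpha>\<^sup>2) * cosh (Re v) \<le> (1 + \<alpha>\<^sup>2) * cos (Im v)"
proof -
  have a: "\<alpha> < 1" using \<alpha> by simp
  define h where "h = h1 \<alpha>"
  define r where "r = r0 \<alpha>"
  define q where "q = \<alpha> * r\<^sup>2"
  define m where "m = 4 * \<alpha> * h\<^sup>2"
  define x where "x = Re z"
  define y where "y = Im z"
  \<comment> \<open>Chosen so that |1 - \<alpha> z^2|^2 = (1 - q)^2 (1 + n) on the circle; n runs
    from 0 at real z to m at imaginary z.\<close>
  define n where "n = 4 * \<alpha> * y\<^sup>2 / (1 - q)\<^sup>2"
  define P where "P = 2 * \<alpha> * h"
  have h0: "1 \<le> h" "h \<le> 2409 / 2000" using h1_ge_1[OF \<alpha>(1) a] h1_le[OF \<alpha>] by (auto simp: h_def)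
  then have hpos: "0 < h" by simp
  have r: "0 < r" "r = h * (1 - q)"
    using bs_radius_pos[OF \<alpha>(1) hpos] bs_radius_eq[OF \<alpha>(1) hpos] by (auto simp: r_def r0_eq h_def q_def)
  have q1: "0 < 1 - q" using r hpos by (metis zero_less_mult_pos)
  have q0: "0 \<le> q" using \<alpha> by (simp add: q_def)
  have r2: "r\<^sup>2 = h\<^sup>2 * (1 - q)\<^sup>2" by (subst r(2)) (simp add: power_mult_distrib)
  have "(1 - q)\<^sup>2 * m = 4 * \<alpha> * (h\<^sup>2 * (1 - q)\<^sup>2)" by (simp add: m_def)
  also have "\<dots> = 4 * q" unfolding r2[symmetric] by (simp add: q_def)
  finally have mq: "(1 - q)\<^sup>2 * m = 4 * q" .
  have qp: "(1 + q)\<^sup>2 = (1 - q)\<^sup>2 * (1 + m)" using mq by algebra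
  have m0: "0 < m" using \<alpha> hpos by (simp add: m_def)
  have n0: "0 \<le> n" using \<alpha> by (simp add: n_def)
  have nq: "(1 - q)\<^sup>2 * n = 4 * \<alpha> * y\<^sup>2" using q1 by (simp add: n_def)
  have xy: "x\<^sup>2 + y\<^sup>2 = r\<^sup>2" using z cmod_power2[of z] by (simp add: x_def y_def r_def)
  define D where "D = 1 - complex_of_real \<alpha> * z\<^sup>2"
  have zz: "z * cnj z = of_real (r\<^sup>2)" using complex_norm_square[of z] z by (simp add: r_def)
  have DD: "D * cnj D = of_real ((1 - q)\<^sup>2 * (1 + n))"
  proof -
    have "(norm D)\<^sup>2 = (1 - \<alpha> * (x\<^sup>2 - y\<^sup>2))\<^sup>2 + (2 * \<alpha> * x * y)\<^sup>2"
      unfolding cmod_power2 D_def by (simp add: x_def y_def power2_eq_square algebra_simps)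
    also have "\<dots> = (1 - q)\<^sup>2 * (1 + n)"
      unfolding distrib_left nq using xy by (simp add: q_def flip: xy) algebra
    finally show ?thesis using complex_norm_square[of D] by simp
  qed
  have d0: "0 < (1 - q)\<^sup>2 * (1 + n)" using q1 n0 by simp
  have "D \<noteq> 0" using DD d0 by (metis mult_zero_left of_real_eq_0_iff order_less_irrefl)
  have "bs_fun \<alpha> z = z * cnj D / (D * cnj D)" 
    unfolding bs_fun_def D_def[symmetric] using \<open>D \<noteq> 0\<close> by simp
  also have "z * cnj D = z - of_real q * cnj z"
    using zz by (simp add: D_def q_def power2_eq_square algebra_simps)
  finally have F: "bs_fun \<alpha> z = (z - of_real q * cnj z) / of_real ((1 - q)\<^sup>2 * (1 + n))" unfolding DD .
  have Rev: "Re v = 2 * \<alpha> * ((1 - q) * x) / ((1 - q)\<^sup>2 * (1 + n))"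
    and Imv: "Im v = 2 * \<alpha> * ((1 + q) * y) / ((1 - q)\<^sup>2 * (1 + n))"
    unfolding v_def F by (simp_all add: x_def y_def algebra_simps)
  define w where "w = (1 + n)\<^sup>2"
  have w0: "0 < w" using n0 by (simp add: w_def)
  have I2: "(Im v)\<^sup>2 = \<alpha> * (1 + m) * n / w"
  proof -
    have "(Im v)\<^sup>2 = \<alpha> * ((1 + q)\<^sup>2 * (4 * \<alpha> * y\<^sup>2)) / ((1 - q)\<^sup>2 * (1 - q)\<^sup>2 * w)"
      unfolding Imv w_def by (simp add: power_divide power_mult_distrib) (simp add: power2_eq_square)
    moreover have "\<alpha> * (e * (1 + m) * (e * n)) / (e * e * w) = \<alpha> * (1 + m) * n / w" if "e \<noteq> 0" for e
      using that by simp
    ultimately show ?thesis unfolding qp nq[symmetric] using q1 by (metis power_not_zero less_irrefl)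
  qed
  have R2: "(Re v)\<^sup>2 = P\<^sup>2 - \<alpha> * n * (1 + 2 * m + m * n) / w"
  proof -
    have "(Re v)\<^sup>2 = 4 * \<alpha>\<^sup>2 * x\<^sup>2 / ((1 - q)\<^sup>2 * w)"
    proof -
      have "2 * \<alpha> * (c * x) / (c\<^sup>2 * (1 + n)) = 2 * \<alpha> * x / (c * (1 + n))" if "c \<noteq> 0" for c
        using that by (simp add: power2_eq_square)
      then have "Re v = 2 * \<alpha> * x / ((1 - q) * (1 + n))" unfolding Rev using q1 by simp
      then show ?thesis by (simp add: w_def power_divide power_mult_distrib)
    qed
    also have "4 * \<alpha>\<^sup>2 * x\<^sup>2 = \<alpha> * (4 * \<alpha> * r\<^sup>2 - 4 * \<alpha> * y\<^sup>2)"
      unfolding xy[symmetric] by (simp add: power2_eq_square algebra_simps)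
    also have "\<dots> = (1 - q)\<^sup>2 * (\<alpha> * (m - n))"
      unfolding nq[symmetric] r2 m_def by (simp add: algebra_simps)
    also have "\<dots> / ((1 - q)\<^sup>2 * w) = \<alpha> * (m - n) / w" using q1 by simp
    also have "\<dots> = P\<^sup>2 - \<alpha> * n * (1 + 2 * m + m * n) / w"
    proof -
      have "P\<^sup>2 = \<alpha> * m" by (simp add: P_def m_def power2_eq_square)
      then show ?thesis using w0 by (simp add: field_simps) (simp add: w_def power2_eq_square algebra_simps)
    qed
    finally show ?thesis .
  qed
  have P0: "0 < P" using \<alpha> hpos by (simp add: P_def)
  have "0 \<le> \<alpha> * n * (1 + 2 * m + m * n) / w" using \<alpha> n0 m0 w0 by simp
  then have "(Re v)\<^sup>2 \<le> P\<^sup>2" unfolding R2 by simp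
  then have ReP: "\<bar>Re v\<bar> \<le> P" using P0 abs_le_square_iff[of "Re v" P] by simp
  have expP: "exp P = (1 + \<alpha>) / (1 - \<alpha>)" using \<alpha> a by (simp add: P_def h_def h1_def)
  have a2: "0 < 1 - \<alpha>\<^sup>2" "0 < 1 + \<alpha>\<^sup>2" using \<alpha> a by (auto simp: abs_square_less_1 add_pos_pos)
  have nz: "1 - \<alpha> \<noteq> 0" "1 + \<alpha> \<noteq> 0" using \<alpha> a by auto
  have fact: "1 - \<alpha>\<^sup>2 = (1 - \<alpha>) * (1 + \<alpha>)" by (simp add: power2_eq_square algebra_simps)
  have coshP: "cosh P = (1 + \<alpha>\<^sup>2) / (1 - \<alpha>\<^sup>2)"
    unfolding cosh_field_def exp_minus expP fact using nz by (simp add: divide_simps) (simp add: power2_eq_square algebra_simps)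
  have sinhP: "sinh P = 2 * \<alpha> / (1 - \<alpha>\<^sup>2)"
    unfolding sinh_field_def exp_minus expP fact using nz by (simp add: divide_simps) (simp add: power2_eq_square algebra_simps)
  have "tanh P = 2 * \<alpha> / (1 + \<alpha>\<^sup>2)" unfolding tanh_def coshP sinhP using a2 by simp
  then have tanhP: "tanh P / (2 * P) = 1 / (2 * ((1 + \<alpha>\<^sup>2) * h))"
    using \<alpha> by (simp add: P_def)
  define W where "W = (1 + \<alpha>\<^sup>2) * h"
  have W0: "0 < W" using a2 hpos by (simp add: W_def)
  have star: "(1 + m) * (1 + 2 / 9 * (\<alpha> * (1 + m) * n / w)) * W \<le> 1 + 2 * m + m * n"
    using circle_estimate[OF \<alpha> gap n0] by (simp add: m_def h_def w_def W_def)
  have q45: "(Im v)\<^sup>2 \<le> 4 / 5"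
  proof -
    have "h\<^sup>2 \<le> (2409/2000)\<^sup>2" using h0 by (intro power_mono) auto
    then have h2: "h\<^sup>2 \<le> 1451 / 1000" by (simp add: power_divide)
    have "\<alpha> * h\<^sup>2 \<le> 33 / 50 * (1451 / 1000)" by (rule mult_mono[OF \<alpha>(2) h2]) simp_all
    then have m: "1 + m \<le> 484 / 100" by (simp add: m_def)
    have am: "\<alpha> * (1 + m) \<le> 33 / 50 * (484 / 100)" by (rule mult_mono[OF \<alpha>(2) m]) (use m0 in simp_all)
    have nw: "n / w \<le> 1 / 4"
    proof -
      have "0 \<le> (1 - n)\<^sup>2" by simp
      then show ?thesis using w0 unfolding pos_divide_le_eq[OF w0] by (simp add: w_def power2_eq_square algebra_simps)
    qed
    have "(Im v)\<^sup>2 = \<alpha> * (1 + m) * (n / w)" unfolding I2 by simp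
    also have "\<dots> \<le> 33 / 50 * (484 / 100) * (1 / 4)"
      by (rule mult_mono[OF am nw]) (use n0 w0 in simp_all)
    also have "\<dots> \<le> 4 / 5" by simp
    finally show ?thesis .
  qed
  define I where "I = (Im v)\<^sup>2"
  have "I / 2 + I\<^sup>2 / 9 \<le> 1 / (2 * W) * (P\<^sup>2 - (Re v)\<^sup>2)"
  proof -
    have "\<alpha> * n / w * ((1 + m) * (1 + 2 / 9 * I) * W) \<le> \<alpha> * n / w * (1 + 2 * m + m * n)"
      using star \<alpha> n0 w0 unfolding I_def I2 by (intro mult_left_mono) auto
    moreover have "\<alpha> * n / w * ((1 + m) * (1 + 2 / 9 * I) * W) = (I + 2 / 9 * I\<^sup>2) * W"
    proof -
      have I: "\<alpha> * n / w * (1 + m) = I" by (simp add: I_def I2)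
      have "\<alpha> * n / w * ((1 + m) * (1 + 2 / 9 * I) * W) = \<alpha> * n / w * (1 + m) * (1 + 2 / 9 * I) * W"
        by (simp only: mult.assoc)
      also have "\<dots> = (I + 2 / 9 * I\<^sup>2) * W"
        unfolding I by (simp add: power2_eq_square algebra_simps)
      finally show ?thesis .
    qed
    moreover have "\<alpha> * n / w * (1 + 2 * m + m * n) = P\<^sup>2 - (Re v)\<^sup>2" unfolding R2 by simp
    ultimately have "(I + 2 / 9 * I\<^sup>2) * W \<le> P\<^sup>2 - (Re v)\<^sup>2" by (simp only:)
    then have "I + 2 / 9 * I\<^sup>2 \<le> (P\<^sup>2 - (Re v)\<^sup>2) / W" using W0 by (simp only: pos_le_divide_eq)
    moreover have "1 / (2 * W) * c = c / W / 2" for c by simp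
    ultimately show ?thesis by simp
  qed
  moreover have "(Im v)^4 = I\<^sup>2" by (simp add: I_def flip: power_mult)
  ultimately have e: "(Im v)\<^sup>2 / 2 + (Im v)^4 / 9 \<le> tanh P / (2 * P) * (P\<^sup>2 - (Re v)\<^sup>2)"
    by (simp only: tanhP W_def[symmetric] I_def[symmetric])
  have "cosh (Re v) \<le> cosh P * exp (- (tanh P / (2 * P) * (P\<^sup>2 - (Re v)\<^sup>2)))"
    by (rule cosh_le_cosh_exp[OF P0 ReP])
  also have "\<dots> \<le> cosh P * exp (- ((Im v)\<^sup>2 / 2 + (Im v)^4 / 9))"
    using e by (intro mult_left_mono) auto
  also have "\<dots> \<le> cosh P * cos (Im v)"
    using exp_le_cos[OF q45] by (intro mult_left_mono) auto
  finally have "(1 - \<alpha>\<^sup>2) * cosh (Re v) \<le> (1 - \<alpha>\<^sup>2) * (cosh P * cos (Im v))"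
    using a2 by (intro mult_left_mono) auto
  then show ?thesis unfolding coshP using a2 by simp
qed

text \<open>The circle gives only |\<Omega>| \<le> 1 for the candidate Schwarz function. The maximum
  principle carries this into the disc and makes it strict there, a constant of modulus 1 being
  excluded by \<Omega>(0) = 0.\<close>

lemma r0_BS_in_F:
  assumes \<alpha>: "0 < \<alpha>" "\<alpha> \<le> 33 / 50" and gap: "alpha0_gap \<alpha> \<le> 0"
  defines "A \<equiv> complex_of_real \<alpha>"
  shows "0 < r0 \<alpha>" "r0 \<alpha> < 1" "BS_in_F_radius \<alpha> A (- A) (r0 \<alpha>)"
    "sharp_BS_in_F_radius \<alpha> A (- A) (r0 \<alpha>)"
proof -
  have a: "\<alpha> < 1" using \<alpha> by simp
  define h where "h = h1 \<alpha>"
  define r where "r = r0 \<alpha>"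
  have h0: "1 \<le> h" "h \<le> 2409 / 2000" using h1_ge_1[OF \<alpha>(1) a] h1_le[OF \<alpha>] by (auto simp: h_def)
  have hpos: "0 < h" using h0 by simp
  have hs: "h * (1 - \<alpha>) < 1" using h1_mult_less_1[OF \<alpha>(1) a] by (simp add: h_def)
  have r_eq: "r = bs_radius \<alpha> h" by (simp add: r_def r0_eq h_def)
  have r: "0 < r" "r < 1"
    using bs_radius_pos[OF \<alpha>(1) hpos] bs_radius_less_1[OF \<alpha>(1) hpos hs] by (auto simp: r_eq)
  then show "0 < r0 \<alpha>" "r0 \<alpha> < 1" by (auto simp: r_def)
  have nA: "norm A = \<alpha>" "norm (- A) = \<alpha>" using \<alpha> by (auto simp: A_def)
  have AA: "A - - A = 2 * of_real \<alpha>" "A \<noteq> - A" using \<alpha> by (auto simp: A_def)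
  define V where "V = (\<lambda>z. 2 * of_real \<alpha> * bs_fun \<alpha> z)"
  have normV: "norm (V z) < pi" if "norm z \<le> r" for z
  proof -
    have "norm (bs_fun \<alpha> z) \<le> h" using norm_bs_fun_le(1)[OF \<alpha>(1) hpos hs] that by (simp add: r_eq)
    then have F: "norm (bs_fun \<alpha> z) \<le> 2409 / 2000" using h0 by simp
    have "\<alpha> * norm (bs_fun \<alpha> z) \<le> 33 / 50 * (2409 / 2000)" by (rule mult_mono[OF \<alpha>(2) F]) simp_all
    then have "norm (V z) < 3" using \<alpha> by (simp add: V_def norm_mult)
    then show ?thesis using pi_gt3 by simp
  qed
  have ImV: "\<bar>Im (V z)\<bar> < pi" if "norm z \<le> r" for z
    using normV[OF that] abs_Im_le_cmod[of "V z"] by linarith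
  \<comment> \<open>A zero would mean exp(V z) = -1, which forces |Im (V z)| \<ge> pi.\<close>
  have ne: "A - (- A) * exp (V z) \<noteq> 0" if "norm z \<le> r" for z
  proof
    assume "A - (- A) * exp (V z) = 0"
    then have "A * (1 + exp (V z)) = 0" by (simp add: algebra_simps)
    then have "exp (V z) = - 1" using \<alpha> by (simp add: A_def add_eq_0_iff)
    moreover have "Ln (exp (V z)) = V z" using ImV[OF that] by (intro Ln_exp) auto
    ultimately have "V z = \<i> * pi" by (metis Ln_minus1)
    then have "Im (V z) = pi" by simp
    then show False using ImV[OF that] by simp
  qed
  define \<Omega> where "\<Omega> = (\<lambda>z. (exp (V z) - 1) / (A - (- A) * exp (V z)))"
  have holV: "V holomorphic_on ball 0 1"
    unfolding V_def using bs_fun_holomorphic[OF \<alpha>(1) a] by (intro holomorphic_intros)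
  have hol: "\<Omega> holomorphic_on cball 0 r"
    unfolding \<Omega>_def using ne r
    by (intro holomorphic_intros holomorphic_on_subset[OF holV]) auto
  have le1: "norm (\<Omega> z) \<le> 1" if "norm z \<le> r" for z
  proof (rule maximum_modulus_frontier[of \<Omega> "cball 0 r"])
    show "\<Omega> holomorphic_on interior (cball 0 r)" using hol by (rule holomorphic_on_subset) auto
    show "continuous_on (closure (cball 0 r)) \<Omega>" using holomorphic_on_imp_continuous_on[OF hol] by simp
    show "norm (\<Omega> z) \<le> 1" if "z \<in> frontier (cball 0 r)" for z
    proof -
      have z: "norm z = r" using that r by simp
      have cA: "1 - cnj A * - A = of_real (1 + \<alpha>\<^sup>2)"
        by (simp add: A_def power2_eq_square)
      have "norm (exp (V z) - 1) \<le> norm (A - (- A) * exp (V z))"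
        unfolding psi_region_iff[OF nA] cA
        using bs_circle_in_psi_region[OF \<alpha> gap, of z] z by (simp add: V_def r_def)
      then show ?thesis using ne[of z] z by (simp add: \<Omega>_def norm_divide divide_le_eq_1)
    qed
  qed (use that in auto)
  have less1: "norm (\<Omega> z) < 1" if z: "norm z < r" for z
  proof (rule ccontr)
    assume "\<not> norm (\<Omega> z) < 1"
    then have "norm (\<Omega> w) \<le> norm (\<Omega> z)" if "w \<in> ball 0 r" for w
      using le1[of w] that by simp
    then have "\<Omega> constant_on ball 0 r"
      using z holomorphic_on_subset[OF hol ball_subset_cball]
      by (intro maximum_modulus_principle[of \<Omega> "ball 0 r" "ball 0 r" z]) auto
    moreover have "0 \<in> ball 0 r" "z \<in> ball 0 r" using r z by auto
    ultimately have "\<Omega> z = \<Omega> 0" by (auto simp: constant_on_def)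
    then have "\<Omega> z = 0" by (simp add: \<Omega>_def V_def bs_fun_def)
    with \<open>\<not> norm (\<Omega> z) < 1\<close> show False by simp
  qed
  show "BS_in_F_radius \<alpha> A (- A) (r0 \<alpha>)"
  proof (rule BS_in_F_radiusI)
    fix z :: complex assume "norm z < r0 \<alpha>"
    then have z: "norm z < r" by (simp add: r_def)
    show "\<bar>Im ((A - - A) * bs_fun \<alpha> z)\<bar> < pi" using ImV[of z] z unfolding AA V_def by simp
    show "norm (exp ((A - - A) * bs_fun \<alpha> z) - 1) < norm (A - - A * exp ((A - - A) * bs_fun \<alpha> z))"
      using less1[OF z] ne[of z] z unfolding AA \<Omega>_def V_def by (simp add: norm_divide divide_less_eq_1)
  qed (use nA \<alpha> a AA r r_def in auto)
  show "sharp_BS_in_F_radius \<alpha> A (- A) (r0 \<alpha>)"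
  proof (rule sharp_BS_in_F_radiusI)
    \<comment> \<open>F(r0) = h1 = psi(1) is a boundary point: both norms to be compared equal 2
      \<alpha>/(1 - \<alpha>).\<close>
    have e: "(A - - A) * bs_fun \<alpha> (of_real (r0 \<alpha>)) = of_real (2 * \<alpha> * h)"
      using bs_fun_bs_radius[OF \<alpha>(1) hpos] unfolding AA r_def[symmetric] r_eq by simp
    have E: "exp (2 * \<alpha> * h) = (1 + \<alpha>) / (1 - \<alpha>)" using \<alpha> a by (simp add: h_def h1_def)
    have "exp (complex_of_real (2 * \<alpha> * h)) = of_real ((1 + \<alpha>) / (1 - \<alpha>))"
      unfolding exp_of_real E ..
    moreover have "complex_of_real ((1 + \<alpha>) / (1 - \<alpha>)) - 1 = of_real (2 * \<alpha> / (1 - \<alpha>))"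
    proof -
      have "(1 + \<alpha>) / (1 - \<alpha>) - 1 = 2 * \<alpha> / (1 - \<alpha>)" using a by (simp add: field_simps)
      then show ?thesis by (metis of_real_1 of_real_diff)
    qed
    moreover have "A - - A * complex_of_real ((1 + \<alpha>) / (1 - \<alpha>)) = of_real (2 * \<alpha> / (1 - \<alpha>))"
    proof -
      have "\<alpha> + \<alpha> * ((1 + \<alpha>) / (1 - \<alpha>)) = 2 * \<alpha> / (1 - \<alpha>)" using a by (simp add: field_simps)
      moreover have "A - - A * of_real c = of_real (\<alpha> + \<alpha> * c)" for c by (simp add: A_def)
      ultimately show ?thesis by (simp only:)
    qed
    ultimately show "norm (A - - A * exp ((A - - A) * bs_fun \<alpha> (of_real (r0 \<alpha>))))
      \<le> norm (exp ((A - - A) * bs_fun \<alpha> (of_real (r0 \<alpha>))) - 1)"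
      unfolding e by simp
  qed (use nA \<alpha> a AA r r_def in auto)
qed

theorem theorem3p6:
  fixes \<alpha> :: real
  assumes "0 < \<alpha>" and "\<alpha> < 1"
  shows "0 < alpha0 \<and> alpha0 < 1 \<and>
    (\<alpha> \<le> alpha0 \<longrightarrow>
       0 < r0 \<alpha> \<and> r0 \<alpha> < 1 \<and>
       BS_in_F_radius \<alpha> (complex_of_real \<alpha>) (- complex_of_real \<alpha>) (r0 \<alpha>) \<and>
       sharp_BS_in_F_radius \<alpha> (complex_of_real \<alpha>) (- complex_of_real \<alpha>) (r0 \<alpha>)) \<and>
    (\<alpha> > alpha0 \<longrightarrow>
       0 < r1 \<alpha> \<and> r1 \<alpha> < 1 \<and>
       BS_in_F_radius \<alpha> (complex_of_real \<alpha>) (- complex_of_real \<alpha>) (r1 \<alpha>)) \<and>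
    (\<forall>\<gamma>. 0 < \<gamma> \<and> \<gamma> \<le> pi / 2 \<longrightarrow>
       0 < r2 \<alpha> \<gamma> \<and> r2 \<alpha> \<gamma> < 1 \<and>
       BS_in_F_radius \<alpha> (complex_of_real \<alpha> * cis \<gamma>) (complex_of_real \<alpha> * cis (- \<gamma>)) (r2 \<alpha> \<gamma>) \<and>
       sharp_BS_in_F_radius \<alpha> (complex_of_real \<alpha> * cis \<gamma>) (complex_of_real \<alpha> * cis (- \<gamma>)) (r2 \<alpha> \<gamma>))"
proof (intro conjI impI allI)
  show "0 < alpha0" "alpha0 < 1" using alpha0_bounds by auto
next
  assume "\<alpha> \<le> alpha0"
  then have "\<alpha> \<le> 33 / 50" "alpha0_gap \<alpha> \<le> 0" using alpha0_bounds alpha0_gap_nonpos assms by auto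
  note r0_BS_in_F[OF assms(1) this]
  then show "0 < r0 \<alpha>" "r0 \<alpha> < 1"
    "BS_in_F_radius \<alpha> (complex_of_real \<alpha>) (- complex_of_real \<alpha>) (r0 \<alpha>)"
    "sharp_BS_in_F_radius \<alpha> (complex_of_real \<alpha>) (- complex_of_real \<alpha>) (r0 \<alpha>)" by blast+
qed (use r1_BS_in_F[OF assms] r2_BS_in_F[OF assms] in auto)

end
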